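(* Let $\mathcal{P}$ be an $(n,m)$-set in $\mathbb{R}^d$, $w:\mathcal{P}\to[0,\infty)$ a weights function, $k\ge1$ an integer, $\alpha\ge1$ and $\delta\in[0,1)$. Let $\tilde D$ be a loss function as in the context, for $\mathcal M=\mathbb{R}^d$. Let $\mathcal{A}$ be an algorithm that solves the case $k=m=1$, i.e., it takes as input a set $Q\subseteq\mathcal M$, a weights function $u:Q\to[0,\infty)$ and the failure probability $\delta$, and in time $T(n)$ outputs $\hat c\in\mathcal M$ that with probability at least $1-\delta$ satisfies $$\sum_{q\in Q}u(q)\,\tilde D(q,\hat c)\le\alpha\cdot\min_{c\in\mathcal M}\sum_{q\in Q}u(q)\,\tilde D(q,c).$$ Then in $T(n)\cdot(nmk)^{O(dk)}$ time we can compute $\hat C\in\mathcal{X}_k$ such that with probability at least $1-k\delta$, $$\sum_{P\in\mathcal{P}}w(P)\,\tilde D(P,\hat C)\le\alpha\cdot\min_{C\in\mathcal{X}_k}\sum_{P\in\mathcal{P}}w(P)\,\tilde D(P,C).$$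
   Context: Loss function: let $\phi:[0,\infty)\to[0,\infty)$ be a non-decreasing function that is $r$-log-log Lipschitz, i.e., there is a constant $0<r<\infty$ such that $\phi(zx)\le z^r\phi(x)$ for every $x,z>0$. Let $(\mathcal M,\mathrm{dist})$ be a metric space (here $\mathcal M=\mathbb{R}^d$). For $P,C\subseteq\mathcal M$ let $\tilde D(P,C):=\min_{p\in P,\,c\in C}\phi(\mathrm{dist}(p,c))$; for points, $\tilde D(q,c):=\tilde D(\{q\},\{c\})$. $\mathcal{X}_k:=\{C\subseteq\mathcal M:|C|=k\}$. An $m$-set is a set of $m$ distinct points of $\mathcal M$; an $(n,m)$-set is a set of $n$ such $m$-sets. *)

theory Defs
  imports "HOL-Probability.Probability"
begin

section \<open>Points, loss and clustering cost\<close>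

text \<open>The dimension \<open>d\<close> occurs in the exponent of the running time, and the hidden constant must
  not depend on it.  Hence \<open>d\<close> has to be a number and not a type: the elements of Euclidean
  \<open>d\<close>-space are the real lists of length \<open>d\<close>.\<close>

type_synonym point = "real list"

definition Rd :: "nat \<Rightarrow> point set" where
  "Rd d = {x. length x = d}"

definition edist :: "point \<Rightarrow> point \<Rightarrow> real" where
  "edist x y = L2_set (\<lambda>i. x ! i - y ! i) {..<length x}"

definition loss_function :: "(real \<Rightarrow> real) \<Rightarrow> real \<Rightarrow> bool" where
  "loss_function \<phi> r \<longleftrightarrow>
     (\<forall>x\<ge>0. 0 \<le> \<phi> x) \<and> mono_on {0..} \<phi> \<and>
     0 < r \<and> (\<forall>x>0. \<forall>z>0. \<phi> (z * x) \<le> z powr r * \<phi> x)"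

text \<open>Only used for finite nonempty \<open>P\<close> and \<open>C\<close>.\<close>

definition set_loss :: "(real \<Rightarrow> real) \<Rightarrow> point set \<Rightarrow> point set \<Rightarrow> real" where
  "set_loss \<phi> P C = Min ((\<lambda>(p, c). \<phi> (edist p c)) ` (P \<times> C))"

definition centers :: "nat \<Rightarrow> nat \<Rightarrow> point set set" where
  "centers d k = {C. C \<subseteq> Rd d \<and> finite C \<and> card C = k}"

definition nm_set :: "nat \<Rightarrow> nat \<Rightarrow> nat \<Rightarrow> point set set \<Rightarrow> bool" where
  "nm_set d n m \<P> \<longleftrightarrow>
     finite \<P> \<and> card \<P> = n \<and> (\<forall>P\<in>\<P>. P \<subseteq> Rd d \<and> finite P \<and> card P = m)"

definition cost :: "(real \<Rightarrow> real) \<Rightarrow> (point set \<Rightarrow> real) \<Rightarrow> point set set \<Rightarrow> point set \<Rightarrow> real" where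
  "cost \<phi> w \<P> C = (\<Sum>P\<in>\<P>. w P * set_loss \<phi> P C)"

definition point_cost :: "(real \<Rightarrow> real) \<Rightarrow> (point \<Rightarrow> real) \<Rightarrow> point set \<Rightarrow> point \<Rightarrow> real" where
  "point_cost \<phi> u Q c = (\<Sum>q\<in>Q. u q * set_loss \<phi> {q} {c})"


section \<open>Randomized algorithms for the case of one center\<close>

text \<open>Inner probability: \<open>Q\<close> contains an event of probability at least \<open>p\<close>.  For a measurable
  \<open>Q\<close> this says that the probability of \<open>Q\<close> is at least \<open>p\<close>.\<close>

definition with_prob :: "'a measure \<Rightarrow> real \<Rightarrow> ('a \<Rightarrow> bool) \<Rightarrow> bool" where
  "with_prob M p Q \<longleftrightarrow> (\<exists>E\<in>sets M. E \<subseteq> {\<omega> \<in> space M. Q \<omega>} \<and> p \<le> measure M E)"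

text \<open>A randomized black-box procedure: from a random seed, the failure probability and a list of
  weighted points it produces a point and the number of time steps it took.  A single real seed
  with an arbitrary distribution can encode an infinite stream of random bits or reals.\<close>

type_synonym solver = "real \<Rightarrow> real \<Rightarrow> (point \<times> real) list \<Rightarrow> point \<times> nat"

text \<open>The set \<open>Q\<close> is presented to the procedure as a list, in an arbitrary order \<open>qs\<close>.\<close>

definition solves_one_center ::
  "(real \<Rightarrow> real) \<Rightarrow> nat \<Rightarrow> real \<Rightarrow> real \<Rightarrow> (nat \<Rightarrow> nat) \<Rightarrow> real measure \<Rightarrow> solver \<Rightarrow> bool" where
  "solves_one_center \<phi> d \<alpha> \<delta> T S A \<longleftrightarrow>
     (\<forall>Q u qs. Q \<subseteq> Rd d \<and> (\<forall>q\<in>Q. 0 \<le> u q) \<and> distinct qs \<and> set qs = Q \<longrightarrow>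
        (\<forall>s\<in>space S.
           fst (A s \<delta> (map (\<lambda>q. (q, u q)) qs)) \<in> Rd d \<and>
           0 < snd (A s \<delta> (map (\<lambda>q. (q, u q)) qs)) \<and>
           snd (A s \<delta> (map (\<lambda>q. (q, u q)) qs)) \<le> T (card Q)) \<and>
        with_prob S (1 - \<delta>)
          (\<lambda>s. point_cost \<phi> u Q (fst (A s \<delta> (map (\<lambda>q. (q, u q)) qs)))
             \<le> \<alpha> * (INF c\<in>Rd d. point_cost \<phi> u Q c)))"


section \<open>The model of computation\<close>

text \<open>A uniform unit-cost model over the reals, in the form of a first-order Lisp: real numbers are
  atoms, all other data are built from atoms with cons cells, and a program is a finite table of
  mutually recursive functions.  The elementary operations, each of which takes one time step, are
  those of a real RAM (arithmetic, square root, comparison, access to memory cells, function call)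
  together with the evaluation of \<open>\<phi>\<close>.  A program may also call the black-box procedure, which is
  charged its own running time.  The only numbers that occur in a program text are integers.\<close>

datatype val = Atom real | Nul | Cell val val

datatype arith = Plus | Minus | Times | Divide

datatype expr =
    Var nat
  | Const int
  | MkNul
  | MkCell expr expr
  | Fst expr
  | Snd expr
  | IfNul expr expr expr
  | IfLess expr expr expr expr
  | Arith arith expr expr
  | Sqrt expr
  | Loss expr
  | Solve expr expr
  | Let expr expr
  | Call nat "expr list"

type_synonym program = "expr list"

fun arith_op :: "arith \<Rightarrow> real \<Rightarrow> real \<Rightarrow> real" where
  "arith_op Plus a b = a + b"
| "arith_op Minus a b = a - b"
| "arith_op Times a b = a * b"
| "arith_op Divide a b = a / b"

fun enc_list :: "('a \<Rightarrow> val) \<Rightarrow> 'a list \<Rightarrow> val" where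
  "enc_list f [] = Nul"
| "enc_list f (x # xs) = Cell (f x) (enc_list f xs)"

definition enc_point :: "point \<Rightarrow> val" where
  "enc_point = enc_list Atom"

definition enc_weighted_points :: "(point \<times> real) list \<Rightarrow> val" where
  "enc_weighted_points = enc_list (\<lambda>(p, a). Cell (enc_point p) (Atom a))"

definition enc_weighted_sets :: "(point list \<times> real) list \<Rightarrow> val" where
  "enc_weighted_sets = enc_list (\<lambda>(ps, a). Cell (enc_list enc_point ps) (Atom a))"

text \<open>\<open>steps \<phi> A \<omega> prog env i e v t j\<close>: in the environment \<open>env\<close> (de Bruijn indices) the expression
  \<open>e\<close> of the program \<open>prog\<close> evaluates to \<open>v\<close> in \<open>t\<close> time steps.  Here \<open>i\<close> and \<open>j\<close> are the numbers
  of calls of the black box made before and after; the call number \<open>i\<close> uses the seed \<open>\<omega> i\<close>.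
  There is no rule for an undefined operation, such as a division by zero.\<close>

inductive
  steps :: "(real \<Rightarrow> real) \<Rightarrow> solver \<Rightarrow> (nat \<Rightarrow> real) \<Rightarrow> program \<Rightarrow>
    val list \<Rightarrow> nat \<Rightarrow> expr \<Rightarrow> val \<Rightarrow> nat \<Rightarrow> nat \<Rightarrow> bool" and
  steps_list :: "(real \<Rightarrow> real) \<Rightarrow> solver \<Rightarrow> (nat \<Rightarrow> real) \<Rightarrow> program \<Rightarrow>
    val list \<Rightarrow> nat \<Rightarrow> expr list \<Rightarrow> val list \<Rightarrow> nat \<Rightarrow> nat \<Rightarrow> bool"
  for \<phi> A \<omega> prog
where
  Var: "x < length env \<Longrightarrow> steps \<phi> A \<omega> prog env i (Var x) (env ! x) 1 i"
| Const: "steps \<phi> A \<omega> prog env i (Const z) (Atom (of_int z)) 1 i"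
| MkNul: "steps \<phi> A \<omega> prog env i MkNul Nul 1 i"
| MkCell: "\<lbrakk>steps \<phi> A \<omega> prog env i e1 v1 t1 j; steps \<phi> A \<omega> prog env j e2 v2 t2 l\<rbrakk>
    \<Longrightarrow> steps \<phi> A \<omega> prog env i (MkCell e1 e2) (Cell v1 v2) (1 + t1 + t2) l"
| Fst: "steps \<phi> A \<omega> prog env i e (Cell v1 v2) t j \<Longrightarrow> steps \<phi> A \<omega> prog env i (Fst e) v1 (1 + t) j"
| Snd: "steps \<phi> A \<omega> prog env i e (Cell v1 v2) t j \<Longrightarrow> steps \<phi> A \<omega> prog env i (Snd e) v2 (1 + t) j"
| IfNul: "\<lbrakk>steps \<phi> A \<omega> prog env i e v t1 j;
      steps \<phi> A \<omega> prog env j (if v = Nul then e1 else e2) v' t2 l\<rbrakk>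
    \<Longrightarrow> steps \<phi> A \<omega> prog env i (IfNul e e1 e2) v' (1 + t1 + t2) l"
| IfLess: "\<lbrakk>steps \<phi> A \<omega> prog env i a (Atom x) t1 j; steps \<phi> A \<omega> prog env j b (Atom y) t2 l;
      steps \<phi> A \<omega> prog env l (if x < y then e1 else e2) v t3 h\<rbrakk>
    \<Longrightarrow> steps \<phi> A \<omega> prog env i (IfLess a b e1 e2) v (1 + t1 + t2 + t3) h"
| Arith: "\<lbrakk>steps \<phi> A \<omega> prog env i e1 (Atom x) t1 j; steps \<phi> A \<omega> prog env j e2 (Atom y) t2 l;
      f = Divide \<longrightarrow> y \<noteq> 0\<rbrakk>
    \<Longrightarrow> steps \<phi> A \<omega> prog env i (Arith f e1 e2) (Atom (arith_op f x y)) (1 + t1 + t2) l"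
| Sqrt: "\<lbrakk>steps \<phi> A \<omega> prog env i e (Atom x) t j; 0 \<le> x\<rbrakk>
    \<Longrightarrow> steps \<phi> A \<omega> prog env i (Sqrt e) (Atom (sqrt x)) (1 + t) j"
| Loss: "\<lbrakk>steps \<phi> A \<omega> prog env i e (Atom x) t j; 0 \<le> x\<rbrakk>
    \<Longrightarrow> steps \<phi> A \<omega> prog env i (Loss e) (Atom (\<phi> x)) (1 + t) j"
| Solve: "\<lbrakk>steps \<phi> A \<omega> prog env i e1 (Atom \<delta>) t1 j;
      steps \<phi> A \<omega> prog env j e2 (enc_weighted_points xs) t2 l;
      A (\<omega> l) \<delta> xs = (c, s)\<rbrakk>
    \<Longrightarrow> steps \<phi> A \<omega> prog env i (Solve e1 e2) (enc_point c) (1 + t1 + t2 + s) (Suc l)"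
| Let: "\<lbrakk>steps \<phi> A \<omega> prog env i e1 v1 t1 j; steps \<phi> A \<omega> prog (v1 # env) j e2 v2 t2 l\<rbrakk>
    \<Longrightarrow> steps \<phi> A \<omega> prog env i (Let e1 e2) v2 (1 + t1 + t2) l"
| Call: "\<lbrakk>steps_list \<phi> A \<omega> prog env i es vs t1 j; f < length prog;
      steps \<phi> A \<omega> prog vs j (prog ! f) v t2 l\<rbrakk>
    \<Longrightarrow> steps \<phi> A \<omega> prog env i (Call f es) v (1 + t1 + t2) l"
| Empty: "steps_list \<phi> A \<omega> prog env i [] [] 0 i"
| More: "\<lbrakk>steps \<phi> A \<omega> prog env i e v t1 j; steps_list \<phi> A \<omega> prog env j es vs t2 l\<rbrakk>
    \<Longrightarrow> steps_list \<phi> A \<omega> prog env i (e # es) (v # vs) (t1 + t2) l"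

text \<open>A program is run by evaluating the body of its first function.\<close>

definition runs_to :: "(real \<Rightarrow> real) \<Rightarrow> solver \<Rightarrow> (nat \<Rightarrow> real) \<Rightarrow> program \<Rightarrow>
    val list \<Rightarrow> val \<Rightarrow> nat \<Rightarrow> bool" where
  "runs_to \<phi> A \<omega> prog args v t \<longleftrightarrow>
     prog \<noteq> [] \<and> (\<exists>j. steps \<phi> A \<omega> prog args 0 (hd prog) v t j)"

text \<open>Evaluation is deterministic once the seeds are fixed, so the existential statements about
  runs speak about the only run.\<close>

lemma enc_list_inj: "inj f \<Longrightarrow> enc_list f xs = enc_list f ys \<longleftrightarrow> xs = ys"
proof (induction xs arbitrary: ys)
  case Nil
  then show ?case by (cases ys) auto
next
  case (Cons a xs)
  then show ?case by (cases ys) (auto dest: injD)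
qed

lemma enc_point_inj: "enc_point x = enc_point y \<longleftrightarrow> x = y"
  unfolding enc_point_def by (rule enc_list_inj) (auto intro: injI)

lemma enc_weighted_points_inj: "enc_weighted_points xs = enc_weighted_points ys \<longleftrightarrow> xs = ys"
  unfolding enc_weighted_points_def
  by (rule enc_list_inj) (auto intro!: injI simp: enc_point_inj split: prod.splits)

lemma steps_deterministic:
  "steps \<phi> A \<omega> prog env i e v t j \<Longrightarrow> steps \<phi> A \<omega> prog env i e v' t' j' \<Longrightarrow>
     v' = v \<and> t' = t \<and> j' = j"
  "steps_list \<phi> A \<omega> prog env i es vs t j \<Longrightarrow> steps_list \<phi> A \<omega> prog env i es vs' t' j' \<Longrightarrow>
     vs' = vs \<and> t' = t \<and> j' = j"
proof (induction arbitrary: v' t' j' and vs' t' j' rule: steps_steps_list.inducts)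
  case (Solve env i e1 \<delta> t1 j e2 xs t2 l c s)
  note IH = Solve(2,4) and eq = Solve(5)
  from Solve.prems show ?case
  proof cases
    case (Solve \<delta>' t1' j1 xs' t2' l' c' s')
    have "\<delta>' = \<delta>" "t1' = t1" "j1 = j"
      using IH(1)[OF Solve(4)] by auto
    moreover from this have "xs' = xs" "t2' = t2" "l' = l"
      using IH(2) Solve(5) enc_weighted_points_inj by blast+
    ultimately show ?thesis using eq Solve by auto
  qed
next
  case Var
  from Var.prems show ?case by cases auto
next
  case Const
  from Const.prems show ?case by cases auto
next
  case MkNul
  from MkNul.prems show ?case by cases auto
next
  case MkCell
  from MkCell.prems show ?case by cases (use MkCell.IH in blast)
next
  case Fst
  from Fst.prems show ?case by cases (use Fst.IH in blast)
next
  case Snd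
  from Snd.prems show ?case by cases (use Snd.IH in blast)
next
  case IfNul
  from IfNul.prems show ?case by cases (use IfNul.IH in blast)
next
  case IfLess
  from IfLess.prems show ?case by cases (use IfLess.IH in blast)
next
  case Arith
  from Arith.prems show ?case by cases (use Arith.IH in blast)
next
  case Sqrt
  from Sqrt.prems show ?case by cases (use Sqrt.IH in blast)
next
  case Loss
  from Loss.prems show ?case by cases (use Loss.IH in blast)
next
  case Let
  from Let.prems show ?case by cases (use Let.IH in blast)
next
  case Call
  from Call.prems show ?case by cases (use Call.IH in blast)
next
  case Empty
  from Empty.prems show ?case by cases auto
next
  case More
  from More.prems show ?case by cases (use More.IH in blast)
qed

lemma runs_to_deterministic:
  assumes "runs_to \<phi> A \<omega> prog args v t" "runs_to \<phi> A \<omega> prog args v' t'"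
  shows "v' = v \<and> t' = t"
  using assms steps_deterministic(1) unfolding runs_to_def by blast

end

theory Submission
  imports Defs
begin

text \<open>
  Let the center \<open>c\<^sub>j\<close> be lifted to \<open>(- 2 c\<^sub>j, \<bar>c\<^sub>j\<bar>\<^sup>2)\<close>.  Then \<open>\<bar>p - c\<^sub>j\<bar>\<^sup>2\<close> is a linear functional of the lifted
  centers and one homogenizing variable, so which pair \<open>(p, j)\<close> is nearest for each of the input sets
  depends only on the cell of an arrangement of hyperplanes through the origin in dimension
  \<open>D = k (d + 1) + 1\<close>.  A generic perturbation makes the nearest pairs unique, and scaling makes the
  nearest pair win by at least one.  These strict inequalities survive when the variables are
  eliminated one after the other: decrease or increase the current variable until some inequality
  \<open>u - v \<ge> 1\<close> becomes tight, and solve it for the variable.  Trying all pivots \<open>(u, v)\<close> in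
  each of the \<open>D\<close> steps yields \<open>(n m k)^O(d k)\<close> assignments, among them one that is consistent with
  any given set of centers.  An assignment decomposes the problem into \<open>k\<close> problems with one center.
  The best of the resulting candidates is at least as good as the candidate of an optimal
  assignment, for which only \<open>k\<close> calls of the black box have to succeed.
\<close>

section \<open>The program\<close>

text \<open>The exponent has to be linear in \<open>d * k\<close> with a constant independent of
  \<open>d\<close>, over the base \<open>n * m * k\<close>. A pivot compares two of the
  \<open>m * k\<close> pairs of one input set, so a level of the search has at most
  \<open>n * (m * k)^2 + 1\<close> branches, which is at most \<open>(n * m * k)^3\<close> once
  \<open>n * m * k\<close> is at least 2. Elimination by single pivots needs no vertices of the
  arrangement, no independent equations and no feasibility test. The price is that a leaf may be an
  assignment that no set of centers induces. Such leaves are harmless: the value computed for an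
  assignment charges every input set for one particular pair of a point and a center, which can only
  exceed its true loss, so the smallest computed value can be taken without checking consistency.
  The assignment used for comparison is chosen by the sum of its one-center optima, hence before any
  seed is drawn, which avoids a union bound over the whole enumeration. For
  \<open>n * m * k = 1\<close> the power is 1 and leaves only a constant multiple of
  \<open>T 1\<close>, so this case takes a separate path.\<close>

abbreviation (input) "f_axpy \<equiv> 1 :: nat"
abbreviation (input) "f_sumsq \<equiv> 2 :: nat"
abbreviation (input) "f_sqdist \<equiv> 3 :: nat"
abbreviation (input) "f_mem \<equiv> 4 :: nat"
abbreviation (input) "f_fresh \<equiv> 5 :: nat"
abbreviation (input) "f_spread \<equiv> 6 :: nat"
abbreviation (input) "f_wsum \<equiv> 7 :: nat"
abbreviation (input) "f_weigh \<equiv> 8 :: nat"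
abbreviation (input) "f_pcost \<equiv> 9 :: nat"
abbreviation (input) "f_solve_all \<equiv> 10 :: nat"
abbreviation (input) "f_points \<equiv> 11 :: nat"
abbreviation (input) "f_cand \<equiv> 12 :: nat"
abbreviation (input) "f_best \<equiv> 13 :: nat"
abbreviation (input) "f_block \<equiv> 14 :: nat"
abbreviation (input) "f_vec \<equiv> 15 :: nat"
abbreviation (input) "f_point_items \<equiv> 16 :: nat"
abbreviation (input) "f_items \<equiv> 17 :: nat"
abbreviation (input) "f_rows \<equiv> 18 :: nat"
abbreviation (input) "f_pivots1 \<equiv> 19 :: nat"
abbreviation (input) "f_pivots2 \<equiv> 20 :: nat"
abbreviation (input) "f_pivots \<equiv> 21 :: nat"
abbreviation (input) "f_elim_row \<equiv> 22 :: nat"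
abbreviation (input) "f_elim_rows \<equiv> 23 :: nat"
abbreviation (input) "f_amin \<equiv> 24 :: nat"
abbreviation (input) "f_leaf \<equiv> 25 :: nat"
abbreviation (input) "f_node \<equiv> 26 :: nat"
abbreviation (input) "f_branch \<equiv> 27 :: nat"
abbreviation (input) "f_general \<equiv> 28 :: nat"

text \<open>For \<open>n = m = k = 1\<close> the time bound does not depend on \<open>d\<close>, so this case must not even read
  the coordinates.\<close>

definition main_body :: expr where
  "main_body =
     (let general = Call f_general [Var 0, Var 1, Var 2] in
      IfLess (Const 1) (Var 1) general
       (IfNul (Snd (Var 0))
         (IfNul (Snd (Fst (Fst (Var 0))))
           (MkCell
             (Solve (Var 2)
               (MkCell (MkCell (Fst (Fst (Fst (Var 0)))) (Snd (Fst (Var 0)))) MkNul))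
             MkNul)
           general)
         general))"

section \<open>Program bodies for vectors, points and weighted lists\<close>

definition axpy_body :: expr where
  "axpy_body =
     IfNul (Var 1) (Var 2)
      (MkCell (Arith Plus (Fst (Var 2)) (Arith Times (Var 0) (Fst (Var 1))))
        (Call f_axpy [Var 0, Snd (Var 1), Snd (Var 2)]))"

definition sumsq_body :: expr where
  "sumsq_body =
     IfNul (Var 0) (Const 0)
      (Arith Plus (Arith Times (Fst (Var 0)) (Fst (Var 0))) (Call f_sumsq [Snd (Var 0)]))"

definition sqdist_body :: expr where
  "sqdist_body = Call f_sumsq [Call f_axpy [Const (- 1), Var 1, Var 0]]"

text \<open>The only test on reals is \<open><\<close>. Equality of points is therefore decided by
  the sign of the squared distance, and \<open>pivots1_body\<close> tests for a nonzero number by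
  the sign of its square.\<close>

definition mem_body :: expr where
  "mem_body =
     IfNul (Var 1) (Const 0)
      (IfLess (Const 0) (Call f_sqdist [Var 0, Fst (Var 1)])
        (Call f_mem [Var 0, Snd (Var 1)])
        (Const 1))"

definition fresh_body :: expr where
  "fresh_body =
     IfNul (Var 0) (Const 1)
      (Arith Plus (Arith Times (Fst (Fst (Var 0))) (Fst (Fst (Var 0))))
        (Call f_fresh [Snd (Var 0)]))"

definition spread_body :: expr where
  "spread_body =
     IfNul (Var 0) MkNul
      (Let (Call f_spread [Snd (Var 0)])
        (MkCell
          (IfLess (Const 0) (Call f_mem [Fst (Var 1), Var 0])
            (MkCell (Call f_fresh [Var 0]) (Snd (Fst (Var 1))))
            (Fst (Var 1)))
          (Var 0)))"

definition wsum_body :: expr where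
  "wsum_body =
     IfNul (Var 1) (Const 0)
      (Let (Call f_wsum [Var 0, Snd (Var 1)])
        (IfLess (Const 0) (Call f_sqdist [Var 1, Fst (Fst (Var 2))])
          (Var 0)
          (Arith Plus (Snd (Fst (Var 2))) (Var 0))))"

definition weigh_body :: expr where
  "weigh_body =
     IfNul (Var 0) MkNul
      (MkCell
        (MkCell (Fst (Var 0)) (Call f_wsum [MkCell (Var 2) (Fst (Var 0)), Var 1]))
        (Call f_weigh [Snd (Var 0), Var 1, Var 2]))"

section \<open>Costs, black-box calls and the best candidate\<close>

definition pcost_body :: expr where
  "pcost_body =
     IfNul (Var 0) (Const 0)
      (Arith Plus
        (Arith Times (Snd (Fst (Var 0)))
          (Loss (Sqrt (Call f_sqdist [Fst (Fst (Var 0)), Var 1]))))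
        (Call f_pcost [Snd (Var 0), Var 1]))"

text \<open>The recursive call precedes the call of the black box, so the call numbers increase with
  the index of the center. The total cost is returned together with the centers, the last center
  first.\<close>

definition solve_all_body :: expr where
  "solve_all_body =
     IfLess (Var 3) (Const 1) (MkCell (Const 0) MkNul)
      (Let (Arith Minus (Var 3) (Const 1))
      (Let (Call f_solve_all [Var 1, Var 2, Var 3, Var 0])
      (Let (Call f_weigh [Var 2, Var 3, Var 1])
      (Let (Solve (Var 5) (Var 0))
        (MkCell (Arith Plus (Call f_pcost [Var 1, Var 0]) (Fst (Var 2)))
          (MkCell (Var 0) (Snd (Var 2))))))))"

definition points_body :: expr where
  "points_body =
     IfNul (Var 0) MkNul (MkCell (Snd (Fst (Fst (Var 0)))) (Call f_points [Snd (Var 0)]))"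

text \<open>The first \<open>f_spread\<close> pads the instance to exactly \<open>n\<close> distinct
  points; the second makes the centers distinct, so that there are exactly \<open>k\<close>.\<close>

definition cand_body :: expr where
  "cand_body =
     Let (Call f_solve_all [Call f_spread [Call f_points [Var 0]], Var 0, Var 2, Var 1])
      (MkCell (Fst (Var 0)) (Call f_spread [Snd (Var 0)]))"

definition best_body :: expr where
  "best_body =
     Let (Call f_cand [Fst (Var 0), Var 1, Var 2])
      (IfNul (Snd (Var 1)) (Var 0)
        (Let (Call f_best [Snd (Var 1), Var 2, Var 3])
          (IfLess (Fst (Var 0)) (Fst (Var 1)) (Var 0) (Var 1))))"

section \<open>Construction of the distance functionals\<close>

definition block_body :: expr where
  "block_body =
     IfNul (Var 0) (MkCell (Var 1) (Var 2))
      (MkCell (Arith Times (Fst (Var 0)) (Var 1)) (Call f_block [Snd (Var 0), Var 1, Var 2]))"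

definition vec_body :: expr where
  "vec_body =
     IfLess (Var 2) (Const 1) (Var 3)
      (Let (Arith Minus (Var 2) (Const 1))
        (Call f_block
          [Var 1,
           IfLess (Var 2) (Var 0) (Const 0) (IfLess (Var 0) (Var 2) (Const 0) (Const 1)),
           Call f_vec [Var 1, Var 2, Var 0, Var 4]]))"

definition point_items_body :: expr where
  "point_items_body =
     IfLess (Var 2) (Const 1) (Var 4)
      (Let (Arith Minus (Var 2) (Const 1))
        (MkCell
          (MkCell (MkCell (MkCell (Var 0) (Var 1)) (Var 2))
            (Call f_vec
              [Var 1, Var 0, Var 4, MkCell (Call f_sumsq [Var 1]) (MkCell (Const 0) MkNul)]))
          (Call f_point_items [Var 1, Var 2, Var 0, Var 4, Var 5])))"

definition items_body :: expr where
  "items_body =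
     IfNul (Var 0) MkNul
      (Call f_point_items
        [Fst (Var 0), Var 1, Var 2, Var 2, Call f_items [Snd (Var 0), Var 1, Var 2]])"

definition rows_body :: expr where
  "rows_body =
     IfNul (Var 0) MkNul
      (MkCell (Call f_items [Fst (Fst (Var 0)), Snd (Fst (Var 0)), Var 1])
        (Call f_rows [Snd (Var 0), Var 1]))"

section \<open>Pivots, elimination and the search tree\<close>

definition pivots1_body :: expr where
  "pivots1_body =
     IfNul (Var 1) (Var 3)
      (Let (Call f_axpy
             [Const (- 1), Var 2, Call f_axpy [Const (- 1), Snd (Fst (Var 1)), Var 0]])
      (Let (Call f_pivots1 [Var 1, Snd (Var 2), Var 3, Var 4])
        (IfLess (Const 0) (Arith Times (Fst (Var 1)) (Fst (Var 1)))
          (MkCell (Var 1) (Var 0))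
          (Var 0))))"

definition pivots2_body :: expr where
  "pivots2_body =
     IfNul (Var 0) (Var 3)
      (Call f_pivots1
        [Snd (Fst (Var 0)), Var 1, Var 2, Call f_pivots2 [Snd (Var 0), Var 1, Var 2, Var 3]])"

definition pivots_body :: expr where
  "pivots_body =
     IfNul (Var 0) (MkCell (MkCell (Const 1) MkNul) MkNul)
      (Call f_pivots2
        [Fst (Var 0), Fst (Var 0), Var 1, Call f_pivots [Snd (Var 0), Var 1]])"

definition elim_row_body :: expr where
  "elim_row_body =
     IfNul (Var 1) MkNul
      (MkCell
        (MkCell (Fst (Fst (Var 1)))
          (Call f_axpy
            [Arith Divide (Fst (Snd (Fst (Var 1)))) (Arith Minus (Const 0) (Fst (Var 0))),
             Snd (Var 0), Snd (Snd (Fst (Var 1)))]))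
        (Call f_elim_row [Var 0, Snd (Var 1)]))"

definition elim_rows_body :: expr where
  "elim_rows_body =
     IfNul (Var 1) MkNul
      (MkCell (Call f_elim_row [Var 0, Fst (Var 1)]) (Call f_elim_rows [Var 0, Snd (Var 1)]))"

definition amin_body :: expr where
  "amin_body =
     IfNul (Snd (Var 0)) (Fst (Var 0))
      (Let (Call f_amin [Snd (Var 0)])
        (IfLess (Fst (Snd (Var 0))) (Fst (Snd (Fst (Var 1)))) (Var 0) (Fst (Var 1))))"

definition leaf_body :: expr where
  "leaf_body =
     IfNul (Var 0) MkNul
      (MkCell (Fst (Call f_amin [Fst (Var 0)])) (Call f_leaf [Snd (Var 0)]))"

definition node_body :: expr where
  "node_body =
     IfNul (Snd (Var 1)) (MkCell (Call f_leaf [Var 0]) (Var 2))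
      (Call f_branch [Call f_pivots [Var 0, Var 1], Var 0, Var 1, Var 2])"

text \<open>The results of the remaining pivots are the accumulator of the current one, so no lists
  have to be appended.\<close>

definition branch_body :: expr where
  "branch_body =
     IfNul (Var 0) (Var 3)
      (Call f_node
        [Call f_elim_rows [Fst (Var 0), Var 1], Snd (Var 2),
         Call f_branch [Snd (Var 0), Var 1, Var 2, Var 3]])"

text \<open>The dimension is not part of the input. It is read off the first point, from which
  \<open>f_vec\<close> with the unmatched label \<open>k\<close> builds the constant
  functional.\<close>

definition general_body :: expr where
  "general_body =
     Snd (Call f_best
      [Call f_node
        [Call f_rows [Var 0, Var 1],
         Call f_vec
          [Fst (Fst (Fst (Var 0))), Var 1, Var 1,
           MkCell (Const 0) (MkCell (Const 1) MkNul)],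
         MkNul],
       Var 1, Var 2])"

definition cluster_prog :: program where
  "cluster_prog =
     [main_body, axpy_body, sumsq_body, sqdist_body, mem_body, fresh_body, spread_body,
      wsum_body, weigh_body, pcost_body, solve_all_body, points_body, cand_body, best_body,
      block_body, vec_body, point_items_body, items_body, rows_body, pivots1_body,
      pivots2_body, pivots_body, elim_row_body, elim_rows_body, amin_body, leaf_body,
      node_body, branch_body, general_body]"


section \<open>The functions computed by the program\<close>

text \<open>\<open>u\<close> may be shorter than \<open>v\<close>, whose tail is then kept. This
  makes \<open>[1]\<close> a legitimate pivot: its tail is empty, so it just drops the first
  coefficient.\<close>

fun axpy :: "real \<Rightarrow> real list \<Rightarrow> real list \<Rightarrow> real list" where
  "axpy s (x # u) (y # v) = (y + s * x) # axpy s u v"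
| "axpy s u v = v"

definition sumsq :: "real list \<Rightarrow> real" where
  "sumsq z = (\<Sum>x\<leftarrow>z. x * x)"

definition sqdist :: "point \<Rightarrow> point \<Rightarrow> real" where
  "sqdist p q = sumsq (axpy (- 1) q p)"

definition fresh :: "point list \<Rightarrow> real" where
  "fresh ys = 1 + (\<Sum>y\<leftarrow>ys. hd y * hd y)"

text \<open>The black box is always called with exactly \<open>n\<close> points, some of them of weight zero, because
  its running time \<open>T\<close> need not be monotone.\<close>

fun spread :: "point list \<Rightarrow> point list" where
  "spread [] = []"
| "spread (x # xs) =
     (let ys = spread xs in (if x \<in> set ys then fresh ys # tl x else x) # ys)"

text \<open>A labelled point is the point with its label, the index of a center, in front.\<close>

definition wsum :: "(point \<times> real) list \<Rightarrow> point \<Rightarrow> real" where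
  "wsum a v = (\<Sum>x\<leftarrow>a. if fst x = v then snd x else 0)"

definition weigh :: "(point \<times> real) list \<Rightarrow> nat \<Rightarrow> point list \<Rightarrow> (point \<times> real) list" where
  "weigh a j Q = map (\<lambda>q. (q, wsum a (real j # q))) Q"

definition pcost :: "(real \<Rightarrow> real) \<Rightarrow> (point \<times> real) list \<Rightarrow> point \<Rightarrow> real" where
  "pcost \<phi> L c = (\<Sum>x\<leftarrow>L. snd x * \<phi> (sqrt (sqdist (fst x) c)))"

definition points :: "(point \<times> real) list \<Rightarrow> point list" where
  "points a = map (tl \<circ> fst) a"

text \<open>With the base \<open>[sumsq p, 0]\<close> this is the functional that maps the lifted centers to the
  squared distance of \<open>p\<close> and center \<open>i\<close>; the last entry is its constant term.  No block matches
  if \<open>i \<ge> j\<close>.\<close>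

fun vec :: "point \<Rightarrow> nat \<Rightarrow> nat \<Rightarrow> real list \<Rightarrow> real list" where
  "vec p i 0 base = base"
| "vec p i (Suc j) base =
     map (\<lambda>x. x * of_bool (i = j)) p @ of_bool (i = j) # vec p i j base"

type_synonym item = "(point \<times> real) \<times> real list"

fun point_items :: "point \<Rightarrow> real \<Rightarrow> nat \<Rightarrow> nat \<Rightarrow> item list" where
  "point_items p w k 0 = []"
| "point_items p w k (Suc j) =
     ((real j # p, w), vec p j k [sumsq p, 0]) # point_items p w k j"

definition items :: "nat \<Rightarrow> point list \<times> real \<Rightarrow> item list" where
  "items k x = concat (map (\<lambda>p. point_items p (snd x) k k) (fst x))"

text \<open>The functional \<open>f\<close> stands for the equation \<open>f = 0\<close>; the constant functional one is \<open>e\<close>.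
  The pivot \<open>[1]\<close> sets the current variable to zero.\<close>

definition pivots1 :: "real list \<Rightarrow> item list \<Rightarrow> real list \<Rightarrow> real list list" where
  "pivots1 e vs g =
     filter (\<lambda>f. hd f \<noteq> 0) (map (\<lambda>v. axpy (- 1) e (axpy (- 1) (snd v) g)) vs)"

definition pivots :: "real list \<Rightarrow> item list list \<Rightarrow> real list list" where
  "pivots e R = concat (map (\<lambda>r. concat (map (\<lambda>u. pivots1 e r (snd u)) r)) R) @ [[1]]"

definition elim :: "real list \<Rightarrow> item \<Rightarrow> item" where
  "elim f u = (fst u, axpy (- hd (snd u) / hd f) (tl f) (tl (snd u)))"

fun amin :: "item list \<Rightarrow> item" where
  "amin [] = undefined"
| "amin [u] = u"
| "amin (u # us) = (let v = amin us in if hd (snd v) < hd (snd u) then v else u)"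

definition leaf :: "item list list \<Rightarrow> (point \<times> real) list" where
  "leaf R = map (fst \<circ> amin) R"

definition unit_vec :: "nat \<Rightarrow> real list" where
  "unit_vec D = replicate D 0 @ [1]"

fun enum :: "nat \<Rightarrow> item list list \<Rightarrow> (point \<times> real) list list" where
  "enum 0 R = [leaf R]"
| "enum (Suc D) R =
     concat (map (\<lambda>f. enum D (map (map (elim f)) R)) (pivots (unit_vec (Suc D)) R))"

context
  fixes \<phi> :: "real \<Rightarrow> real" and A :: solver and \<omega> :: "nat \<Rightarrow> real"
begin

text \<open>\<open>i\<close> counts the black-box calls made before this candidate, which owns the
  \<open>k\<close> seeds from \<open>i\<close> on.\<close>

definition center :: "real \<Rightarrow> (point \<times> real) list \<Rightarrow> nat \<Rightarrow> nat \<Rightarrow> point" where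
  "center \<delta> a i j = fst (A (\<omega> (i + j)) \<delta> (weigh a j (spread (points a))))"

definition cand :: "real \<Rightarrow> nat \<Rightarrow> (point \<times> real) list \<Rightarrow> nat \<Rightarrow> real \<times> point list" where
  "cand \<delta> k a i =
     (\<Sum>j<k. pcost \<phi> (weigh a j (spread (points a))) (center \<delta> a i j),
      spread (map (center \<delta> a i) (rev [0..<k])))"

fun best :: "real \<Rightarrow> nat \<Rightarrow> (point \<times> real) list list \<Rightarrow> nat \<Rightarrow> real \<times> point list" where
  "best \<delta> k [] i = undefined"
| "best \<delta> k [a] i = cand \<delta> k a i"
| "best \<delta> k (a # as) i =
     (let x = cand \<delta> k a i; y = best \<delta> k as (i + k) in if fst y < fst x then y else x)"


section \<open>Symbolic execution with time bounds\<close>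

text \<open>Value and call counter are exact, but the time is only bounded. The rules below then
  assemble a bound by unification, and a single inequality per function compares it with the claimed
  one.\<close>

definition evals :: "val list \<Rightarrow> nat \<Rightarrow> expr \<Rightarrow> val \<Rightarrow> nat \<Rightarrow> nat \<Rightarrow> bool" where
  "evals env i e v B j \<longleftrightarrow> (\<exists>t\<le>B. steps \<phi> A \<omega> cluster_prog env i e v t j)"

definition evals_list :: "val list \<Rightarrow> nat \<Rightarrow> expr list \<Rightarrow> val list \<Rightarrow> nat \<Rightarrow> nat \<Rightarrow> bool" where
  "evals_list env i es vs B j \<longleftrightarrow>
     (\<exists>t\<le>B. steps_list \<phi> A \<omega> cluster_prog env i es vs t j)"

definition calls :: "nat \<Rightarrow> val list \<Rightarrow> nat \<Rightarrow> val \<Rightarrow> nat \<Rightarrow> nat \<Rightarrow> bool" where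
  "calls f vs i v B j \<longleftrightarrow> f < length cluster_prog \<and> evals vs i (cluster_prog ! f) v B j"

lemma evals_mono:
  assumes "evals env i e v B j" "v = v'" "B \<le> B'" "j = j'"
  shows "evals env i e v' B' j'"
  using assms unfolding evals_def by (meson order_trans)

text \<open>Keeps the bodies folded: \<open>bodies\<close> resolves a function number by
  unification, and only the body under execution gets unfolded.\<close>

definition is_body :: "nat \<Rightarrow> expr \<Rightarrow> bool" where
  "is_body f e \<longleftrightarrow> f < length cluster_prog \<and> cluster_prog ! f = e"

lemma bodies:
  "is_body f_axpy axpy_body" "is_body f_sumsq sumsq_body" "is_body f_sqdist sqdist_body"
  "is_body f_mem mem_body" "is_body f_fresh fresh_body" "is_body f_spread spread_body"
  "is_body f_wsum wsum_body" "is_body f_weigh weigh_body" "is_body f_pcost pcost_body"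
  "is_body f_solve_all solve_all_body" "is_body f_points points_body"
  "is_body f_cand cand_body" "is_body f_best best_body" "is_body f_block block_body"
  "is_body f_vec vec_body" "is_body f_point_items point_items_body"
  "is_body f_items items_body" "is_body f_rows rows_body" "is_body f_pivots1 pivots1_body"
  "is_body f_pivots2 pivots2_body" "is_body f_pivots pivots_body"
  "is_body f_elim_row elim_row_body" "is_body f_elim_rows elim_rows_body"
  "is_body f_amin amin_body" "is_body f_leaf leaf_body" "is_body f_node node_body"
  "is_body f_branch branch_body" "is_body f_general general_body"
  by (simp_all add: is_body_def cluster_prog_def)

lemma callsI:
  assumes "is_body f e" "evals vs i e v B j" "v = v'" "B \<le> B'" "j = j'"
  shows "calls f vs i v' B' j'"
  using assms evals_mono unfolding calls_def is_body_def by blast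

lemma calls_mono:
  assumes "calls f vs i v B j" "v = v'" "B \<le> B'" "j = j'"
  shows "calls f vs i v' B' j'"
  using assms evals_mono unfolding calls_def by blast

lemma evals_Var:
  "evals (v0 # env) i (Var 0) v0 1 i"
  "evals (v0 # v1 # env) i (Var 1) v1 1 i"
  "evals (v0 # v1 # v2 # env) i (Var 2) v2 1 i"
  "evals (v0 # v1 # v2 # v3 # env) i (Var 3) v3 1 i"
  "evals (v0 # v1 # v2 # v3 # v4 # env) i (Var 4) v4 1 i"
  "evals (v0 # v1 # v2 # v3 # v4 # v5 # env) i (Var 5) v5 1 i"
  unfolding evals_def
  using Var[of 0 "v0 # env"] Var[of 1 "v0 # v1 # env"] Var[of 2 "v0 # v1 # v2 # env"]
    Var[of 3 "v0 # v1 # v2 # v3 # env"] Var[of 4 "v0 # v1 # v2 # v3 # v4 # env"]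
    Var[of 5 "v0 # v1 # v2 # v3 # v4 # v5 # env"]
  by (auto intro!: exI[of _ 1])

lemma evals_Const:
  "evals env i (Const 0) (Atom 0) 1 i" "evals env i (Const 1) (Atom 1) 1 i"
  "evals env i (Const (- 1)) (Atom (- 1)) 1 i"
  unfolding evals_def
  using Const[of \<phi> A \<omega> cluster_prog env i 0] Const[of \<phi> A \<omega> cluster_prog env i 1]
    Const[of \<phi> A \<omega> cluster_prog env i "- 1"]
  by (auto intro!: exI[of _ 1])

lemma evals_MkNul: "evals env i MkNul Nul 1 i"
  unfolding evals_def using MkNul by blast

lemma evals_MkCell:
  assumes "evals env i e1 v1 B1 j" "evals env j e2 v2 B2 l"
  shows "evals env i (MkCell e1 e2) (Cell v1 v2) (1 + B1 + B2) l"
  using assms unfolding evals_def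
  by (meson MkCell add_le_mono order_refl)

lemma evals_Fst:
  assumes "evals env i e (Cell v1 v2) B j"
  shows "evals env i (Fst e) v1 (1 + B) j"
  using assms unfolding evals_def by (meson Fst add_le_mono order_refl)

lemma evals_Snd:
  assumes "evals env i e (Cell v1 v2) B j"
  shows "evals env i (Snd e) v2 (1 + B) j"
  using assms unfolding evals_def by (meson Snd add_le_mono order_refl)

lemma evals_IfNul:
  assumes "evals env i e v B1 j" "evals env j (if v = Nul then e1 else e2) v' B2 l"
  shows "evals env i (IfNul e e1 e2) v' (1 + B1 + B2) l"
  using assms unfolding evals_def by (meson IfNul add_le_mono order_refl)

lemma evals_if_Nul:
  "evals env i e1 v B j \<Longrightarrow> evals env i (if Nul = Nul then e1 else e2) v B j"
  "evals env i e2 v B j \<Longrightarrow> evals env i (if Cell a b = Nul then e1 else e2) v B j"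
  by simp_all

lemma evals_IfLess:
  assumes "evals env i a (Atom x) B1 j" "evals env j b (Atom y) B2 l"
    "evals env l (if x < y then e1 else e2) v B3 h"
  shows "evals env i (IfLess a b e1 e2) v (1 + B1 + B2 + B3) h"
  using assms unfolding evals_def by (meson IfLess add_le_mono order_refl)

text \<open>Both branches are executed symbolically and the larger time is charged. This requires
  that they make the same number of black-box calls.\<close>

lemma evals_if:
  assumes "evals env i e1 v1 B1 j" "evals env i e2 v2 B2 j"
  shows "evals env i (if (x::real) < y then e1 else e2) (if x < y then v1 else v2) (max B1 B2) j"
  using assms unfolding evals_def by (auto intro: le_max_iff_disj[THEN iffD2])

lemma evals_if_Atom:
  assumes "evals env i e1 (Atom a) B1 j" "evals env i e2 (Atom b) B2 j"
  shows "evals env i (if (x::real) < y then e1 else e2) (Atom (if x < y then a else b))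
    (max B1 B2) j"
  using evals_if[OF assms] by (simp add: if_distrib)

text \<open>For the tests that end a recursion on a number: there only the branch that is taken may
  be executed.\<close>

lemma evals_if_const:
  "c \<Longrightarrow> evals env i e1 v B j \<Longrightarrow> evals env i (if c then e1 else e2) v B j"
  "\<not> c \<Longrightarrow> evals env i e2 v B j \<Longrightarrow> evals env i (if c then e1 else e2) v B j"
  by simp_all

lemma evals_Arith:
  assumes "evals env i e1 (Atom x) B1 j" "evals env j e2 (Atom y) B2 l"
  shows "evals env i (Arith Plus e1 e2) (Atom (x + y)) (1 + B1 + B2) l"
    and "evals env i (Arith Minus e1 e2) (Atom (x - y)) (1 + B1 + B2) l"
    and "evals env i (Arith Times e1 e2) (Atom (x * y)) (1 + B1 + B2) l"
    and "y \<noteq> 0 \<Longrightarrow> evals env i (Arith Divide e1 e2) (Atom (x / y)) (1 + B1 + B2) l"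
proof -
  obtain t1 t2 where t: "t1 \<le> B1" "t2 \<le> B2" "steps \<phi> A \<omega> cluster_prog env i e1 (Atom x) t1 j"
    "steps \<phi> A \<omega> cluster_prog env j e2 (Atom y) t2 l"
    using assms unfolding evals_def by blast
  have "evals env i (Arith f e1 e2) (Atom (arith_op f x y)) (1 + B1 + B2) l"
    if "f = Divide \<longrightarrow> y \<noteq> 0" for f
    unfolding evals_def using Arith[OF t(3,4) that] t(1,2)
    by (meson add_le_mono order_refl)
  from this[of Plus] this[of Minus] this[of Times] this[of Divide]
  show "evals env i (Arith Plus e1 e2) (Atom (x + y)) (1 + B1 + B2) l"
    and "evals env i (Arith Minus e1 e2) (Atom (x - y)) (1 + B1 + B2) l"
    and "evals env i (Arith Times e1 e2) (Atom (x * y)) (1 + B1 + B2) l"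
    and "y \<noteq> 0 \<Longrightarrow> evals env i (Arith Divide e1 e2) (Atom (x / y)) (1 + B1 + B2) l"
    by simp_all
qed

lemma evals_Sqrt:
  assumes "evals env i e (Atom x) B j" "0 \<le> x"
  shows "evals env i (Sqrt e) (Atom (sqrt x)) (1 + B) j"
  using assms unfolding evals_def by (meson Sqrt add_le_mono order_refl)

lemma evals_Loss:
  assumes "evals env i e (Atom x) B j" "0 \<le> x"
  shows "evals env i (Loss e) (Atom (\<phi> x)) (1 + B) j"
  using assms unfolding evals_def by (meson Loss add_le_mono order_refl)

lemma evals_Solve:
  assumes "evals env i e1 (Atom \<delta>) B1 j" "evals env j e2 (enc_weighted_points xs) B2 l"
    "snd (A (\<omega> l) \<delta> xs) \<le> B3"
  shows "evals env i (Solve e1 e2) (enc_point (fst (A (\<omega> l) \<delta> xs))) (1 + B1 + B2 + B3) (Suc l)"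
proof -
  obtain t1 t2 where t: "t1 \<le> B1" "t2 \<le> B2" "steps \<phi> A \<omega> cluster_prog env i e1 (Atom \<delta>) t1 j"
    "steps \<phi> A \<omega> cluster_prog env j e2 (enc_weighted_points xs) t2 l"
    using assms unfolding evals_def by blast
  show ?thesis
    unfolding evals_def
    by (rule exI, rule conjI[rotated], rule Solve[OF t(3,4) prod.collapse[symmetric]])
      (use t(1,2) assms(3) in simp)
qed

lemma evals_Let:
  assumes "evals env i e1 v1 B1 j" "evals (v1 # env) j e2 v2 B2 l"
  shows "evals env i (Let e1 e2) v2 (1 + B1 + B2) l"
  using assms unfolding evals_def by (meson Let add_le_mono order_refl)

lemma evals_Nil: "evals_list env i [] [] 0 i"
  unfolding evals_list_def using Empty by blast

lemma evals_Cons: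
  assumes "evals env i e v B1 j" "evals_list env j es vs B2 l"
  shows "evals_list env i (e # es) (v # vs) (B1 + B2) l"
  using assms unfolding evals_def evals_list_def by (meson More add_le_mono)

lemma evals_Call:
  assumes "evals_list env i es vs B1 j" "calls f vs j v B2 l"
  shows "evals env i (Call f es) v (1 + B1 + B2) l"
  using assms unfolding evals_def evals_list_def calls_def
  by (meson Call add_le_mono order_refl)

lemmas evals_rules = evals_Var evals_Const evals_MkNul evals_MkCell evals_Fst evals_Snd
  evals_IfNul evals_if_Nul evals_IfLess evals_Arith evals_Sqrt evals_Loss evals_Let
  evals_Nil evals_Cons evals_Call

section \<open>Cost of the vector and point routines\<close>

lemma enc_point_simps: "enc_point [] = Nul" "enc_point (x # xs) = Cell (Atom x) (enc_point xs)"
  by (simp_all add: enc_point_def)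

lemma axpy_calls:
  \<comment> \<open>The constants here and in the later bounds are not tuned. They are large enough
    for each recursive step to be paid by the growth of the bound.\<close>
  "length u \<le> length v \<Longrightarrow>
     calls f_axpy [Atom s, enc_point u, enc_point v] i (enc_point (axpy s u v)) (20 * length u + 10) i"
proof (induction u arbitrary: v)
  case Nil
  show ?case
    apply (rule callsI, rule bodies)
       apply (simp only: enc_point_simps axpy_body_def)
       apply (rule evals_rules)+
    by simp_all
next
  case (Cons x u)
  then obtain y v' where v: "v = y # v'" "length u \<le> length v'" by (cases v) auto
  show ?case unfolding v(1)
    apply (rule callsI, rule bodies)
       apply (simp only: enc_point_simps axpy_body_def)
       apply (rule evals_rules Cons.IH | (simp add: v; fail))+
    by (simp_all add: enc_point_simps)
qed

lemma length_axpy: "length (axpy s u v) = length v"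
  by (induction s u v rule: axpy.induct) auto

lemma sumsq_calls: "calls f_sumsq [enc_point z] i (Atom (sumsq z)) (20 * length z + 10) i"
proof (induction z)
  case Nil
  show ?case
    apply (rule callsI, rule bodies)
       apply (simp only: enc_point_simps sumsq_body_def)
       apply (rule evals_rules)+
    by (simp_all add: sumsq_def)
next
  case (Cons x z)
  show ?case
    apply (rule callsI, rule bodies)
       apply (simp only: enc_point_simps sumsq_body_def)
       apply (rule evals_rules Cons.IH)+
    by (simp_all add: sumsq_def)
qed

lemma sqdist_calls:
  assumes "length p = d" "length q = d"
  shows "calls f_sqdist [enc_point p, enc_point q] i (Atom (sqdist p q)) (50 * d + 50) i"
  apply (rule callsI, rule bodies)
     apply (simp only: sqdist_body_def)
     apply (rule evals_rules axpy_calls sumsq_calls | (simp add: assms; fail))+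
  using assms by (simp_all add: sqdist_def length_axpy)

lemma sqdist_nonneg: "0 \<le> sqdist p q"
  by (auto simp: sqdist_def sumsq_def intro!: sum_list_nonneg)

lemma sqdist_Cons: "sqdist (x # p) (y # q) = (x - y)\<^sup>2 + sqdist p q"
  by (simp add: sqdist_def sumsq_def power2_eq_square)

lemma sqdist_pos_iff: "length p = length q \<Longrightarrow> 0 < sqdist p q \<longleftrightarrow> p \<noteq> q"
proof (induction p q rule: list_induct2)
  case Nil
  then show ?case by (simp add: sqdist_def sumsq_def)
next
  case (Cons x p y q)
  have "0 < (x - y)\<^sup>2 + sqdist p q \<longleftrightarrow> x \<noteq> y \<or> 0 < sqdist p q"
    using sqdist_nonneg[of p q]
    by (metis add_0 add_pos_nonneg power_zero_numeral right_minus_eq zero_less_power2)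
  then show ?case using Cons by (simp add: sqdist_Cons)
qed

lemma mem_calls:
  assumes "length x = d"
  shows "\<forall>y\<in>set ys. length y = d \<Longrightarrow>
    calls f_mem [enc_point x, enc_list enc_point ys] i (Atom (of_bool (x \<in> set ys)))
      (100 * (d + 1) * (length ys + 1)) i"
proof (induction ys)
  case Nil
  show ?case
    apply (rule callsI, rule bodies)
       apply (simp only: enc_list.simps mem_body_def)
       apply (rule evals_rules)+
    by simp_all
next
  case (Cons y ys)
  have IH: "calls f_mem [enc_point x, enc_list enc_point ys] i (Atom (of_bool (x \<in> set ys)))
      (100 * (d + 1) * (length ys + 1)) i"
    using Cons by simp
  show ?case
    apply (rule callsI, rule bodies)
       apply (simp only: enc_list.simps mem_body_def)
       apply (rule evals_rules evals_if IH sqdist_calls[of _ d] | (use Cons assms in simp; fail))+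
    using Cons.prems assms by (auto simp: sqdist_pos_iff algebra_simps)
qed

lemma fresh_calls:
  "\<forall>y\<in>set ys. y \<noteq> [] \<Longrightarrow>
     calls f_fresh [enc_list enc_point ys] i (Atom (fresh ys)) (20 * length ys + 10) i"
proof (induction ys)
  case Nil
  show ?case
    apply (rule callsI, rule bodies)
       apply (simp only: enc_list.simps fresh_body_def)
       apply (rule evals_rules)+
    by (simp_all add: fresh_def)
next
  case (Cons y ys)
  then obtain a y' where y: "y = a # y'" by (cases y) auto
  have IH: "calls f_fresh [enc_list enc_point ys] i (Atom (fresh ys)) (20 * length ys + 10) i"
    using Cons by simp
  show ?case unfolding y
    apply (rule callsI, rule bodies)
       apply (simp only: enc_list.simps enc_point_simps fresh_body_def)
       apply (rule evals_rules IH)+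
    by (simp_all add: fresh_def)
qed

text \<open>Since \<open>t < 1 + t * t\<close>, \<open>fresh ys\<close> exceeds every first
  coordinate in \<open>ys\<close>, so the replacement is a new point. A point is replaced only when
  it already occurs in the spread tail, so none is lost.\<close>

lemma spread_props:
  assumes "0 < d" "\<forall>x\<in>set xs. length x = d"
  shows "length (spread xs) = length xs" "distinct (spread xs)"
    "\<forall>x\<in>set (spread xs). length x = d" "set xs \<subseteq> set (spread xs)"
proof -
  have hd_less: "hd y < fresh ys" if "y \<in> set ys" for y ys
  proof -
    have "t < 1 + t * t" for t :: real
      using zero_le_square[of "t - 1"] zero_le_square[of t]
      unfolding left_diff_distrib right_diff_distrib by linarith
    then have "hd y < 1 + hd y * hd y" .
    also have "\<dots> \<le> fresh ys"
      unfolding fresh_def using that by (auto intro!: member_le_sum_list)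
    finally show ?thesis .
  qed
  have "length (spread xs) = length xs \<and> distinct (spread xs) \<and>
    (\<forall>x\<in>set (spread xs). length x = d) \<and> set xs \<subseteq> set (spread xs)"
    using assms(2)
  proof (induction xs)
    case (Cons x xs)
    have "fresh (spread xs) # tl x \<notin> set (spread xs)"
      using hd_less[of "fresh (spread xs) # tl x" "spread xs"] by auto
    then show ?case using Cons assms(1) by (auto simp: Let_def)
  qed simp
  then show "length (spread xs) = length xs" "distinct (spread xs)"
    "\<forall>x\<in>set (spread xs). length x = d" "set xs \<subseteq> set (spread xs)" by auto
qed

lemma spread_calls:
  assumes "0 < d"
  shows "\<forall>x\<in>set xs. length x = d \<Longrightarrow>
    calls f_spread [enc_list enc_point xs] i (enc_list enc_point (spread xs))
      (200 * (d + 1) * (length xs + 1)\<^sup>2) i"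
proof (induction xs)
  case Nil
  show ?case
    apply (rule callsI, rule bodies)
       apply (simp only: enc_list.simps spread_body_def)
       apply (rule evals_rules)+
    by simp_all
next
  case (Cons x xs)
  then obtain a x' where x: "x = a # x'" using assms by (cases x) auto
  have IH: "calls f_spread [enc_list enc_point xs] i (enc_list enc_point (spread xs))
      (200 * (d + 1) * (length xs + 1)\<^sup>2) i"
    using Cons by simp
  have props: "\<forall>y\<in>set (spread xs). length y = d" "length (spread xs) = length xs"
    using spread_props[OF assms] Cons.prems by auto
  have ne: "\<forall>y\<in>set (spread xs). y \<noteq> []"
    using props assms by auto
  note mem = mem_calls[of x d "spread xs", unfolded x enc_point_simps]
  show ?case unfolding x
    apply (rule callsI, rule bodies)
       apply (simp only: enc_list.simps enc_point_simps spread_body_def)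
       apply (rule evals_rules evals_if IH mem fresh_calls[OF ne]
        | (use Cons x props in simp; fail))+
    by (simp_all add: enc_point_simps Let_def props algebra_simps power2_eq_square)
qed

end

section \<open>Encodings, weights and candidates\<close>

definition enc_tag :: "point \<times> real \<Rightarrow> val" where
  "enc_tag x = Cell (enc_point (fst x)) (Atom (snd x))"

definition enc_wset :: "point list \<times> real \<Rightarrow> val" where
  "enc_wset x = Cell (enc_list enc_point (fst x)) (Atom (snd x))"

definition enc_item :: "item \<Rightarrow> val" where
  "enc_item u = Cell (enc_tag (fst u)) (enc_point (snd u))"

lemma enc_tag_Pair: "enc_tag (v, w) = Cell (enc_point v) (Atom w)"
  by (simp add: enc_tag_def)

lemma enc_weighted_points_eq: "enc_weighted_points = enc_list enc_tag"
  unfolding enc_weighted_points_def enc_tag_def by (simp add: case_prod_beta')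

lemma enc_weighted_sets_eq: "enc_weighted_sets = enc_list enc_wset"
  unfolding enc_weighted_sets_def enc_wset_def by (simp add: case_prod_beta')

context
  fixes \<phi> :: "real \<Rightarrow> real" and A :: solver and \<omega> :: "nat \<Rightarrow> real"
begin

lemma wsum_calls:
  assumes "length v = d"
  shows "\<forall>x\<in>set a. length (fst x) = d \<Longrightarrow>
    calls \<phi> A \<omega> f_wsum [enc_point v, enc_list enc_tag a] i (Atom (wsum a v))
      (100 * (d + 1) * (length a + 1)) i"
proof (induction a)
  case Nil
  show ?case
    apply (rule callsI, rule bodies)
       apply (simp only: enc_list.simps wsum_body_def)
       apply (rule evals_rules)+
    by (simp_all add: wsum_def)?
next
  case (Cons x a)
  have IH: "calls \<phi> A \<omega> f_wsum [enc_point v, enc_list enc_tag a] i (Atom (wsum a v))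
      (100 * (d + 1) * (length a + 1)) i"
    using Cons by simp
  show ?case
    apply (rule callsI, rule bodies)
       apply (simp only: enc_list.simps enc_tag_def[of x] wsum_body_def)
       apply (rule evals_rules evals_if IH sqdist_calls[of _ d] | (use Cons assms in simp; fail))+
    using Cons.prems assms by (auto simp: sqdist_pos_iff wsum_def algebra_simps)
qed

lemma weigh_calls:
  assumes a: "\<forall>x\<in>set a. length (fst x) = Suc d" and r: "r = real j"
  shows "\<forall>q\<in>set Q. length q = d \<Longrightarrow>
    calls \<phi> A \<omega> f_weigh [enc_list enc_point Q, enc_list enc_tag a, Atom r] i
      (enc_list enc_tag (weigh a j Q)) (100 * (d + 2) * (length a + 2) * (length Q + 1)) i"
proof (induction Q)
  case Nil
  show ?case
    apply (rule callsI, rule bodies)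
       apply (simp only: enc_list.simps weigh_body_def)
       apply (rule evals_rules)+
    by (simp_all add: weigh_def)?
next
  case (Cons q Q)
  have IH: "calls \<phi> A \<omega> f_weigh [enc_list enc_point Q, enc_list enc_tag a, Atom r] i
      (enc_list enc_tag (weigh a j Q)) (100 * (d + 2) * (length a + 2) * (length Q + 1)) i"
    using Cons by simp
  note ws = wsum_calls[of "real j # q" "Suc d" a, unfolded enc_point_simps, folded r]
  show ?case
    apply (rule callsI, rule bodies)
       apply (simp only: enc_list.simps weigh_body_def)
       apply (rule evals_rules IH ws | (use Cons a in simp; fail))+
    by (simp_all add: weigh_def enc_tag_Pair r algebra_simps)?
qed

lemma pcost_calls:
  assumes "length c = d"
  shows "\<forall>x\<in>set L. length (fst x) = d \<Longrightarrow>
    calls \<phi> A \<omega> f_pcost [enc_list enc_tag L, enc_point c] i (Atom (pcost \<phi> L c))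
      (100 * (d + 1) * (length L + 1)) i"
proof (induction L)
  case Nil
  show ?case
    apply (rule callsI, rule bodies)
       apply (simp only: enc_list.simps pcost_body_def)
       apply (rule evals_rules)+
    by (simp_all add: pcost_def)?
next
  case (Cons x L)
  have IH: "calls \<phi> A \<omega> f_pcost [enc_list enc_tag L, enc_point c] i (Atom (pcost \<phi> L c))
      (100 * (d + 1) * (length L + 1)) i"
    using Cons by simp
  show ?case
    apply (rule callsI, rule bodies)
       apply (simp only: enc_list.simps enc_tag_def[of x] pcost_body_def)
       apply (rule evals_rules IH sqdist_calls[of _ d] sqdist_nonneg
        | (use Cons assms in \<open>simp add: sqdist_nonneg\<close>; fail))+
    using Cons.prems assms by (auto simp: pcost_def algebra_simps)
qed

lemma solve_all_calls:
  assumes Q: "\<forall>q\<in>set Q. length q = d" and a: "\<forall>x\<in>set a. length (fst x) = Suc d"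
    and t: "\<And>i j. snd (A (\<omega> i) \<delta> (weigh a j Q)) \<le> t"
    and len: "\<And>i j. length (fst (A (\<omega> i) \<delta> (weigh a j Q))) = d"
  shows "r = real k \<Longrightarrow>
    calls \<phi> A \<omega> f_solve_all [enc_list enc_point Q, enc_list enc_tag a, Atom \<delta>, Atom r] i
      (Cell (Atom (\<Sum>j<k. pcost \<phi> (weigh a j Q) (fst (A (\<omega> (i + j)) \<delta> (weigh a j Q)))))
        (enc_list enc_point (map (\<lambda>j. fst (A (\<omega> (i + j)) \<delta> (weigh a j Q))) (rev [0..<k]))))
      ((k + 1) * (300 * (d + 2) * (length a + 2) * (length Q + 1) + t)) (i + k)"
proof (induction k arbitrary: r)
  case 0
  show ?case unfolding 0
    apply (rule callsI, rule bodies)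
       apply (simp only: solve_all_body_def)
       apply (rule evals_rules evals_if_const(1) | (simp; fail))+
    by (simp_all)?
next
  case (Suc k)
  note IH = Suc.IH[of "r - 1"]
  have Q': "\<forall>x\<in>set (weigh a j Q). length (fst x) = d" for j
    using Q by (auto simp: weigh_def)
  note sol = evals_Solve[where \<phi> = \<phi> and A = A and \<omega> = \<omega>, unfolded enc_weighted_points_eq] t
  note we = weigh_calls[OF a _ Q, of "r - 1" k] and pc = pcost_calls[OF len Q']
  have l: "length (weigh a k Q) = length Q" by (simp add: weigh_def)
  show ?case
    apply (rule callsI, rule bodies)
       apply (simp only: solve_all_body_def)
       apply (rule evals_rules evals_if_const(2) IH sol we pc | (use Suc.prems in simp; fail))+
    by (simp_all add: l algebra_simps)?
qed

lemma points_calls: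
  "\<forall>x\<in>set a. fst x \<noteq> [] \<Longrightarrow>
    calls \<phi> A \<omega> f_points [enc_list enc_tag a] i (enc_list enc_point (points a))
      (20 * length a + 10) i"
proof (induction a)
  case Nil
  show ?case
    apply (rule callsI, rule bodies)
       apply (simp only: enc_list.simps points_body_def)
       apply (rule evals_rules)+
    by (simp_all add: points_def)?
next
  case (Cons x a)
  have IH: "calls \<phi> A \<omega> f_points [enc_list enc_tag a] i (enc_list enc_point (points a))
      (20 * length a + 10) i"
    using Cons by simp
  obtain j p where x: "fst x = j # p" using Cons.prems by (cases "fst x") auto
  show ?case
    apply (rule callsI, rule bodies)
       apply (simp only: enc_list.simps enc_tag_def[of x] x enc_point_simps points_body_def)
       apply (rule evals_rules IH)+
    by (simp_all add: points_def x)?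
qed

text \<open>The promise of the black box for the instances that come from the assignment
  \<open>a\<close>. All labels \<open>j\<close> are allowed: a label that does not occur just gives
  an instance with zero weights.\<close>

definition good_solver :: "nat \<Rightarrow> real \<Rightarrow> nat \<Rightarrow> (point \<times> real) list \<Rightarrow> bool" where
  "good_solver d \<delta> t a \<longleftrightarrow> (\<forall>x\<in>set a. length (fst x) = Suc d) \<and>
     (\<forall>i j. snd (A (\<omega> i) \<delta> (weigh a j (spread (points a)))) \<le> t \<and>
            length (fst (A (\<omega> i) \<delta> (weigh a j (spread (points a))))) = d)"

lemma cand_calls:
  assumes d: "0 < d" and g: "good_solver d \<delta> t a" and n: "length a = n"
  shows "calls \<phi> A \<omega> f_cand [enc_list enc_tag a, Atom (real k), Atom \<delta>] i
    (Cell (Atom (fst (cand \<phi> A \<omega> \<delta> k a i))) (enc_list enc_point (snd (cand \<phi> A \<omega> \<delta> k a i))))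
    ((k + 1) * (1000 * (d + 2) * (n + 2)\<^sup>2 + 1000 * (d + 1) * (k + 1) + t)) (i + k)"
proof -
  let ?Q = "spread (points a)"
  from g have a: "\<forall>x\<in>set a. length (fst x) = Suc d"
    and t: "\<And>i j. snd (A (\<omega> i) \<delta> (weigh a j ?Q)) \<le> t"
    and len: "\<And>i j. length (fst (A (\<omega> i) \<delta> (weigh a j ?Q))) = d"
    unfolding good_solver_def by auto
  have p: "\<forall>x\<in>set (points a). length x = d" "length (points a) = n"
    using a n by (auto simp: points_def)
  have ne: "\<forall>x\<in>set a. fst x \<noteq> []" using a by auto
  have l: "length ?Q = n" using spread_props(1)[OF d p(1)] p(2) by simp
  have center_eq: "center A \<omega> \<delta> a i = (\<lambda>j. fst (A (\<omega> (i + j)) \<delta> (weigh a j ?Q)))"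
    by (rule ext) (simp add: center_def)
  note rules = points_calls[OF ne] spread_calls[OF d p(1)] spread_calls[OF d]
    solve_all_calls[OF spread_props(3)[OF d p(1)] a t len refl]
  show ?thesis
    apply (rule callsI, rule bodies)
       apply (simp only: cand_body_def)
       apply (rule evals_rules rules | (simp add: len; fail))+
    by (simp_all add: cand_def center_eq l p n algebra_simps power2_eq_square)?
qed

lemma best_calls:
  assumes d: "0 < d"
  shows "as \<noteq> [] \<Longrightarrow> \<forall>a\<in>set as. good_solver d \<delta> t a \<and> length a = n \<Longrightarrow>
    calls \<phi> A \<omega> f_best [enc_list (enc_list enc_tag) as, Atom (real k), Atom \<delta>] i
    (Cell (Atom (fst (best \<phi> A \<omega> \<delta> k as i))) (enc_list enc_point (snd (best \<phi> A \<omega> \<delta> k as i))))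
    (length as * ((k + 1) * (1000 * (d + 2) * (n + 2)\<^sup>2 + 1000 * (d + 1) * (k + 1) + t) + 50))
    (i + length as * k)"
proof (induction as arbitrary: i)
  case (Cons a as)
  note c = cand_calls[OF d, of \<delta> t a n]
  show ?case
  proof (cases as)
    case Nil
    show ?thesis unfolding Nil
      apply (rule callsI, rule bodies)
         apply (simp only: enc_list.simps best_body_def)
         apply (rule evals_rules c | (use Cons.prems in simp; fail))+
      by (simp_all)?
  next
    case as: (Cons b bs)
    note IH = Cons.IH[unfolded as enc_list.simps]
    have "best \<phi> A \<omega> \<delta> k (a # as) i = (let x = cand \<phi> A \<omega> \<delta> k a i; y = best \<phi> A \<omega> \<delta> k as (i + k)
      in if fst y < fst x then y else x)"
      unfolding as by simp
    then show ?thesis unfolding as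
      apply -
      apply (rule callsI, rule bodies)
         apply (simp only: enc_list.simps best_body_def)
         apply (rule evals_rules evals_if c IH | (use Cons.prems as in simp; fail))+
      by (simp_all add: Let_def algebra_simps)?
  qed
qed simp

end

context
  fixes \<phi> :: "real \<Rightarrow> real" and A :: solver and \<omega> :: "nat \<Rightarrow> real"
begin

section \<open>Cost of building the functionals\<close>

lemma block_calls:
  "calls \<phi> A \<omega> f_block [enc_point p, Atom s, enc_point rest] i
    (enc_point (map (\<lambda>x. x * s) p @ s # rest)) (20 * length p + 10) i"
proof (induction p)
  case Nil
  show ?case
    apply (rule callsI, rule bodies)
       apply (simp only: enc_point_simps block_body_def)
       apply (rule evals_rules)+
    by (simp_all add: enc_point_simps)?
next
  case (Cons x p)
  show ?case
    apply (rule callsI, rule bodies)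
       apply (simp only: enc_point_simps block_body_def)
       apply (rule evals_rules Cons.IH)+
    by (simp_all add: enc_point_simps)?
qed

lemma vec_calls:
  assumes "length p = d" and l: "q = real l"
  shows "r = real j \<Longrightarrow>
    calls \<phi> A \<omega> f_vec [enc_point p, Atom q, Atom r, enc_point base] i
      (enc_point (vec p l j base)) (100 * (d + 1) * (j + 1)) i"
proof (induction j arbitrary: r)
  case 0
  show ?case unfolding 0
    apply (rule callsI, rule bodies)
       apply (simp only: vec_body_def)
       apply (rule evals_rules evals_if_const(1) | (simp; fail))+
    by (simp_all)?
next
  case (Suc j)
  note IH = Suc.IH[of "r - 1"]
  have b: "(if q < r - 1 then 0 else if r - 1 < q then 0 else 1) = (of_bool (l = j) :: real)"
    using Suc.prems l by auto
  show ?case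
    apply (rule callsI, rule bodies)
       apply (simp only: vec_body_def)
       apply (rule evals_rules evals_if_const(2)[of "r < 1"] evals_if_Atom IH block_calls
        | (use Suc.prems in simp; fail))+
    by (simp_all only: b vec.simps, simp_all add: assms algebra_simps)?
qed

lemma point_items_calls:
  assumes p: "length p = d"
  shows "r = real j \<Longrightarrow>
    calls \<phi> A \<omega> f_point_items [enc_point p, Atom w, Atom r, Atom (real k), enc_list enc_item acc] i
      (enc_list enc_item (point_items p w k j @ acc)) (200 * (d + 1) * (k + 2) * (j + 1)) i"
proof (induction j arbitrary: r)
  case 0
  show ?case unfolding 0
    apply (rule callsI, rule bodies)
       apply (simp only: point_items_body_def)
       apply (rule evals_rules evals_if_const(1) | (simp; fail))+
    by (simp_all)?
next
  case (Suc j)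
  note IH = Suc.IH[of "r - 1"]
  note v = vec_calls[OF p, of "r - 1" j _ _ "[sumsq p, 0]", unfolded enc_point_simps]
  show ?case
    apply (rule callsI, rule bodies)
       apply (simp only: point_items_body_def)
       apply (rule evals_rules evals_if_const(2)[of "r < 1"] IH v sumsq_calls
        | (use Suc.prems in simp; fail))+
    by (simp_all add: Suc.prems enc_item_def enc_tag_Pair enc_point_simps p algebra_simps)?
qed

lemma items_calls:
  "\<forall>p\<in>set ps. length p = d \<Longrightarrow>
    calls \<phi> A \<omega> f_items [enc_list enc_point ps, Atom w, Atom (real k)] i
      (enc_list enc_item (items k (ps, w))) (200 * (d + 1) * (k + 2) * (k + 2) * (length ps + 1)) i"
proof (induction ps)
  case Nil
  show ?case
    apply (rule callsI, rule bodies)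
       apply (simp only: enc_list.simps items_body_def)
       apply (rule evals_rules)+
    by (simp_all add: items_def)?
next
  case (Cons p ps)
  note IH = Cons.IH[OF ballI]
  show ?case
    apply (rule callsI, rule bodies)
       apply (simp only: enc_list.simps items_body_def)
       apply (rule evals_rules IH point_items_calls[of _ d] | (use Cons.prems in simp; fail))+
    by (simp_all add: items_def algebra_simps)?
qed

lemma rows_calls:
  "\<forall>x\<in>set Ws. length (fst x) = m \<and> (\<forall>p\<in>set (fst x). length p = d) \<Longrightarrow>
    calls \<phi> A \<omega> f_rows [enc_list enc_wset Ws, Atom (real k)] i
      (enc_list (enc_list enc_item) (map (items k) Ws))
      (200 * (d + 1) * (k + 2) * (k + 2) * (m + 2) * (length Ws + 1)) i"
proof (induction Ws)
  case Nil
  show ?case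
    apply (rule callsI, rule bodies)
       apply (simp only: enc_list.simps rows_body_def)
       apply (rule evals_rules)+
    by (simp_all)?
next
  case (Cons x Ws)
  note IH = Cons.IH[OF ballI]
  show ?case
    apply (rule callsI, rule bodies)
       apply (simp only: enc_list.simps enc_wset_def[of x] rows_body_def)
       apply (rule evals_rules IH items_calls[of _ d] | (use Cons.prems in simp; fail))+
    using Cons.prems by (simp_all add: algebra_simps)?
qed

section \<open>Cost of pivots, elimination and leaves\<close>

lemma pivots1_calls:
  assumes g: "length g = Suc l" and e: "length e = Suc l"
  shows "\<forall>v\<in>set vs. length (snd v) = Suc l \<Longrightarrow>
    calls \<phi> A \<omega> f_pivots1 [enc_point g, enc_list enc_item vs, enc_point e, enc_list enc_point acc] i
      (enc_list enc_point (pivots1 e vs g @ acc)) (100 * (l + 2) * (length vs + 1)) i"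
proof (induction vs)
  case Nil
  show ?case
    apply (rule callsI, rule bodies)
       apply (simp only: enc_list.simps pivots1_body_def)
       apply (rule evals_rules)+
    by (simp_all add: pivots1_def)?
next
  case (Cons v vs)
  note IH = Cons.IH[OF ballI]
  have l: "length (snd v) \<le> length g" "length e \<le> length (axpy (- 1) (snd v) g)"
    using Cons.prems g e by (simp_all add: length_axpy)
  obtain b f where f: "axpy (- 1) e (axpy (- 1) (snd v) g) = b # f"
    using g by (metis length_axpy length_Suc_conv)
  note ax = axpy_calls[OF l(1), of \<phi> A \<omega> "- 1"]
    axpy_calls[OF l(2), of \<phi> A \<omega> "- 1", unfolded f enc_point_simps]
  show ?case
    apply (rule callsI, rule bodies)
       apply (simp only: enc_list.simps enc_item_def[of v] pivots1_body_def)
       apply (rule evals_rules evals_if ax IH | (use Cons.prems in simp; fail))+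
    using Cons.prems
    by (simp_all add: pivots1_def f enc_point_simps e zero_less_mult_iff linorder_neq_iff disj_commute
        algebra_simps)?
qed

lemma pivots2_calls:
  assumes e: "length e = Suc l" and vs: "\<forall>v\<in>set vs. length (snd v) = Suc l"
  shows "\<forall>u\<in>set us. length (snd u) = Suc l \<Longrightarrow>
    calls \<phi> A \<omega> f_pivots2
      [enc_list enc_item us, enc_list enc_item vs, enc_point e, enc_list enc_point acc] i
      (enc_list enc_point (concat (map (\<lambda>u. pivots1 e vs (snd u)) us) @ acc))
      (100 * (l + 2) * (length vs + 2) * (length us + 1)) i"
proof (induction us)
  case Nil
  show ?case
    apply (rule callsI, rule bodies)
       apply (simp only: enc_list.simps pivots2_body_def)
       apply (rule evals_rules)+
    by (simp_all)?
next
  case (Cons u us)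
  note IH = Cons.IH[OF ballI]
  show ?case
    apply (rule callsI, rule bodies)
       apply (simp only: enc_list.simps enc_item_def[of u] pivots2_body_def)
       apply (rule evals_rules pivots1_calls[OF _ e vs] IH | (use Cons.prems in simp; fail))+
    by (simp_all add: algebra_simps)?
qed

definition row_shape :: "nat \<Rightarrow> nat \<Rightarrow> item list \<Rightarrow> bool" where
  "row_shape M D r \<longleftrightarrow> length r = M \<and> (\<forall>u\<in>set r. length (snd u) = Suc D)"

lemma pivots_calls:
  assumes e: "length e = Suc l"
  shows "\<forall>r\<in>set R. row_shape M l r \<Longrightarrow>
    calls \<phi> A \<omega> f_pivots [enc_list (enc_list enc_item) R, enc_point e] i
      (enc_list enc_point (pivots e R)) (100 * (l + 2) * (M + 2)\<^sup>2 * (length R + 1)) i"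
proof (induction R)
  case Nil
  show ?case
    apply (rule callsI, rule bodies)
       apply (simp only: enc_list.simps pivots_body_def)
       apply (rule evals_rules)+
    by (simp_all add: pivots_def enc_point_simps power2_eq_square)?
next
  case (Cons r R)
  note IH = Cons.IH[OF ballI]
  have r: "\<forall>u\<in>set r. length (snd u) = Suc l" "length r = M"
    using Cons.prems by (auto simp: row_shape_def)
  show ?case
    apply (rule callsI, rule bodies)
       apply (simp only: enc_list.simps pivots_body_def)
       apply (rule evals_rules pivots2_calls[OF e r(1) r(1)] IH | (use Cons.prems in simp; fail))+
    by (simp_all add: pivots_def r(2) algebra_simps power2_eq_square)?
qed

lemma elim_row_calls:
  assumes f: "b \<noteq> 0" "length f \<le> l"
  shows "\<forall>u\<in>set us. length (snd u) = Suc l \<Longrightarrow>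
    calls \<phi> A \<omega> f_elim_row [enc_point (b # f), enc_list enc_item us] i
      (enc_list enc_item (map (elim (b # f)) us)) (50 * (l + 2) * (length us + 1)) i"
proof (induction us)
  case Nil
  show ?case
    apply (rule callsI, rule bodies)
       apply (simp only: enc_list.simps elim_row_body_def)
       apply (rule evals_rules)+
    by (simp_all)?
next
  case (Cons u us)
  note IH = Cons.IH[OF ballI, unfolded enc_point_simps]
  obtain a g where g: "snd u = a # g" "length g = l"
    using Cons.prems by (cases "snd u") auto
  show ?case
    apply (rule callsI, rule bodies)
       apply (simp only: enc_list.simps enc_item_def[of u] g enc_point_simps elim_row_body_def)
       apply (rule evals_rules axpy_calls IH | (use Cons.prems f g in simp; fail))+
    using f by (simp_all add: enc_item_def elim_def g algebra_simps)?
qed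

lemma elim_rows_calls:
  assumes f: "b \<noteq> 0" "length f \<le> l"
  shows "\<forall>r\<in>set R. row_shape M l r \<Longrightarrow>
    calls \<phi> A \<omega> f_elim_rows [enc_point (b # f), enc_list (enc_list enc_item) R] i
      (enc_list (enc_list enc_item) (map (map (elim (b # f))) R))
      (50 * (l + 2) * (M + 2) * (length R + 1)) i"
proof (induction R)
  case Nil
  show ?case
    apply (rule callsI, rule bodies)
       apply (simp only: enc_list.simps elim_rows_body_def)
       apply (rule evals_rules)+
    by (simp_all)?
next
  case (Cons r R)
  note IH = Cons.IH[OF ballI]
  have r: "\<forall>u\<in>set r. length (snd u) = Suc l" "length r = M"
    using Cons.prems by (auto simp: row_shape_def)
  show ?case
    apply (rule callsI, rule bodies)
       apply (simp only: enc_list.simps elim_rows_body_def)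
       apply (rule evals_rules elim_row_calls[OF f r(1)] IH | (use Cons.prems in simp; fail))+
    by (simp_all add: r(2) algebra_simps)?
qed

lemma amin_in_set: "us \<noteq> [] \<Longrightarrow> amin us \<in> set us"
  by (induction us rule: amin.induct) (auto simp: Let_def)

lemma amin_calls:
  "us \<noteq> [] \<Longrightarrow> \<forall>u\<in>set us. snd u \<noteq> [] \<Longrightarrow>
    calls \<phi> A \<omega> f_amin [enc_list enc_item us] i (enc_item (amin us)) (50 * length us) i"
proof (induction us rule: amin.induct)
  case (2 u)
  show ?case
    apply (rule callsI, rule bodies)
       apply (simp only: enc_list.simps amin_body_def)
       apply (rule evals_rules)+
    by (simp_all)?
next
  case (3 u v us)
  let ?m = "amin (v # us)"
  have IH: "calls \<phi> A \<omega> f_amin [enc_list enc_item (v # us)] i (enc_item ?m)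
      (50 * length (v # us)) i"
    using 3 by simp
  obtain a g where g: "snd u = a # g" using 3 by (cases "snd u") auto
  have "snd ?m \<noteq> []" using amin_in_set[of "v # us"] "3.prems" by auto
  then obtain b h where h: "snd ?m = b # h" by (cases "snd ?m") auto
  note IH' = IH[unfolded enc_item_def[of ?m] h enc_point_simps enc_list.simps]
  show ?case
    apply (rule callsI, rule bodies)
       apply (simp only: enc_list.simps enc_item_def[of u] g enc_point_simps amin_body_def)
       apply (rule evals_rules evals_if IH')+
    by (simp_all add: Let_def g h enc_item_def enc_point_simps)?
qed simp

lemma leaf_calls:
  "\<forall>r\<in>set R. row_shape M l r \<Longrightarrow> 0 < M \<Longrightarrow>
    calls \<phi> A \<omega> f_leaf [enc_list (enc_list enc_item) R] i (enc_list enc_tag (leaf R))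
      (50 * (M + 1) * (length R + 1)) i"
proof (induction R)
  case Nil
  show ?case
    apply (rule callsI, rule bodies)
       apply (simp only: enc_list.simps leaf_body_def)
       apply (rule evals_rules)+
    by (simp_all add: leaf_def)?
next
  case (Cons r R)
  note IH = Cons.IH[OF ballI]
  have r: "r \<noteq> []" "\<forall>u\<in>set r. snd u \<noteq> []" "length r = M"
    using Cons.prems by (auto simp: row_shape_def)
  show ?case
    apply (rule callsI, rule bodies)
       apply (simp only: enc_list.simps leaf_body_def)
       apply (rule evals_rules amin_calls[OF r(1,2), unfolded enc_item_def[of "amin r"]] IH
          | (use Cons.prems in simp; fail))+
    by (simp_all add: leaf_def r(3) algebra_simps)?
qed

section \<open>Size and cost of the search tree\<close>

lemma row_shape_elim:
  "row_shape M (Suc D) r \<Longrightarrow> row_shape M D (map (elim f) r)"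
  by (auto simp: row_shape_def elim_def length_axpy)

lemma length_unit_vec: "length (unit_vec D) = Suc D"
  by (simp add: unit_vec_def)

text \<open>What elimination needs from a pivot: the division is defined and the tail fits into the
  rows. The short pivot \<open>[1]\<close> is the reason for an inequality between the
  lengths.\<close>

lemma pivots_shape:
  assumes "\<forall>r\<in>set R. row_shape M l r" "f \<in> set (pivots e R)"
  shows "\<exists>b f'. f = b # f' \<and> b \<noteq> 0 \<and> length f' \<le> l"
proof -
  have "length (snd u) = Suc l" if "r \<in> set R" "u \<in> set r" for r u
    using that assms(1) by (auto simp: row_shape_def)
  then have "f = [1] \<or> (hd f \<noteq> 0 \<and> length f = Suc l)"
    using assms(2) by (fastforce simp: pivots_def pivots1_def length_axpy)
  then show ?thesis by (cases f) auto
qed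

text \<open>At most one pivot for each ordered pair within a row, and \<open>[1]\<close>.\<close>

lemma length_pivots:
  "\<forall>r\<in>set R. row_shape M l r \<Longrightarrow> length (pivots e R) \<le> length R * M\<^sup>2 + 1"
proof (induction R)
  case (Cons r R)
  have "length (concat (map (\<lambda>u. pivots1 e r (snd u)) us)) \<le> length us * length r" for us
  proof (induction us)
    case (Cons u us)
    have "length (pivots1 e r (snd u)) \<le> length r"
      unfolding pivots1_def by (metis length_filter_le length_map)
    then show ?case using Cons by simp
  qed simp
  from this[of r] Cons show ?case
    by (auto simp: pivots_def row_shape_def power2_eq_square)
qed (simp add: pivots_def)

lemma length_enum:
  "\<forall>r\<in>set R. row_shape M D r \<Longrightarrow> length (enum D R) \<le> (length R * M\<^sup>2 + 1) ^ D"
proof (induction D arbitrary: R)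
  case (Suc D)
  let ?P = "length R * M\<^sup>2 + 1"
  have IH: "length (enum D (map (map (elim f)) R)) \<le> ?P ^ D" for f
    using Suc.IH[of "map (map (elim f)) R"] Suc.prems row_shape_elim by auto
  have "length (concat (map (\<lambda>f. enum D (map (map (elim f)) R)) fs)) \<le> length fs * ?P ^ D" for fs
    by (induction fs) (use IH in \<open>auto intro: add_mono\<close>)
  also have "length (pivots e R) * ?P ^ D \<le> ?P * ?P ^ D" for e
    using length_pivots[OF Suc.prems] by (intro mult_right_mono) auto
  finally show ?case by simp
qed simp

text \<open>A node has at most \<open>P\<close> children, and \<open>Z\<close> pays for its own work
  including the elimination for every child. The induction rests on
  \<open>Z + P * (Z * (P + 1) ^ D) <= Z * (P + 1) ^ Suc D\<close>. The common bound \<open>L\<close>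
  of all depths keeps \<open>Z\<close> fixed throughout.\<close>

lemma node_calls:
  fixes L M n :: nat
  defines "P \<equiv> n * M\<^sup>2 + 1"
  defines "Z \<equiv> P * (200 * (L + 3) * (M + 2)\<^sup>2 * (n + 1))"
  assumes M: "0 < M"
  shows "\<forall>r\<in>set R. row_shape M D r \<Longrightarrow> length R = n \<Longrightarrow> D \<le> L \<Longrightarrow>
    calls \<phi> A \<omega> f_node
      [enc_list (enc_list enc_item) R, enc_point (unit_vec D), enc_list (enc_list enc_tag) acc] i
      (enc_list (enc_list enc_tag) (enum D R @ acc)) (Z * (P + 1) ^ D) i"
proof (induction D arbitrary: R acc)
  case 0
  have "100 * ((M + 1) * (n + 1)) \<le> 1 * (200 * (L + 3) * (M + 2)\<^sup>2 * (n + 1))"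
    by (simp add: power2_eq_square algebra_simps)
  also have "\<dots> \<le> Z"
    unfolding Z_def P_def by (intro mult_right_mono) auto
  finally have Z: "50 * (M + 1) * (n + 1) + 10 \<le> Z" by (simp add: algebra_simps)
  have u: "unit_vec 0 = [1]" by (simp add: unit_vec_def)
  show ?case
    apply (rule callsI, rule bodies)
       apply (simp only: u enc_point_simps node_body_def)
       apply (rule evals_rules leaf_calls[OF 0(1) M])+
    using Z 0 by (simp_all add: algebra_simps)?
next
  case (Suc D)
  let ?T = "Z * (P + 1) ^ D" and ?W = "100 * (L + 2) * (M + 2) * (n + 1)"
  have u: "unit_vec (Suc D) = 0 # unit_vec D" by (simp add: unit_vec_def)
  obtain b c where bc: "unit_vec D = b # c" by (simp add: unit_vec_def) (metis append_is_Nil_conv list.exhaust not_Cons_self2)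
  have branch: "calls \<phi> A \<omega> f_branch
      [enc_list enc_point fs, enc_list (enc_list enc_item) R, enc_point (unit_vec (Suc D)),
       enc_list (enc_list enc_tag) acc] i
      (enc_list (enc_list enc_tag)
        (concat (map (\<lambda>f. enum D (map (map (elim f)) R)) fs) @ acc))
      (length fs * (?W + ?T) + 20) i"
    if "set fs \<subseteq> set (pivots (unit_vec (Suc D)) R)" for fs
    using that
  proof (induction fs)
    case Nil
    show ?case
      apply (rule callsI, rule bodies)
         apply (simp only: enc_list.simps branch_body_def)
         apply (rule evals_rules)+
      by (simp_all)?
  next
    case (Cons f fs)
    have "set fs \<subseteq> set (pivots (unit_vec (Suc D)) R)" using Cons.prems by simp
    note IH = Cons.IH[OF this, unfolded u enc_point_simps]
    obtain b f' where f: "f = b # f'" "b \<noteq> 0" "length f' \<le> Suc D"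
      using pivots_shape[OF Suc.prems(1)] Cons.prems by (meson list.set_intros(1) subsetD)
    have sh: "\<forall>r\<in>set (map (map (elim f)) R). row_shape M D r"
      using Suc.prems(1) row_shape_elim by auto
    note node = Suc.IH[OF sh, simplified length_map, OF Suc.prems(2)]
    note el = elim_rows_calls[OF f(2,3) Suc.prems(1), folded f(1)]
    have W: "50 * (D + 3) * (M + 2) * (n + 1) + 30 \<le> ?W"
    proof -
      have "50 * (D + 3) * (M + 2) * (n + 1) + 30 \<le> (50 * (D + 3) + 30) * ((M + 2) * (n + 1))"
        by (simp add: algebra_simps)
      also have "\<dots> \<le> 100 * (L + 2) * ((M + 2) * (n + 1))"
        using Suc.prems(3) by (intro mult_right_mono) auto
      finally show ?thesis by (simp only: mult.assoc)
    qed
    show ?case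
      apply (rule callsI, rule bodies)
         apply (simp only: enc_list.simps u enc_point_simps branch_body_def)
         apply (rule evals_rules el node IH | (use Cons.prems Suc.prems in simp; fail))+
      using W Suc.prems(2) by (simp_all add: algebra_simps)?
  qed
  note piv = pivots_calls[OF length_unit_vec Suc.prems(1)]
  have "100 * (D + 3) * (M + 2)\<^sup>2 * (n + 1) + length (pivots (unit_vec (Suc D)) R) * (?W + ?T) + 40
      \<le> 100 * (L + 2) * (M + 2)\<^sup>2 * (n + 1) + P * (?W + ?T) + 40"
  proof (rule add_right_mono, rule add_mono)
    show "100 * (D + 3) * (M + 2)\<^sup>2 * (n + 1) \<le> 100 * (L + 2) * (M + 2)\<^sup>2 * (n + 1)"
      using Suc.prems(3) by (intro mult_right_mono) auto
    show "length (pivots (unit_vec (Suc D)) R) * (?W + ?T) \<le> P * (?W + ?T)"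
      using length_pivots[OF Suc.prems(1)] Suc.prems(2)
      by (intro mult_right_mono) (auto simp: P_def)
  qed
  also have "\<dots> \<le> Z + P * ?T"
  proof -
    have "?W * P \<le> 50 * (L + 2) * (M + 2)\<^sup>2 * (n + 1) * P"
      by (intro mult_right_mono) (simp_all add: power2_eq_square algebra_simps)
    moreover have "100 * (L + 2) * (M + 2)\<^sup>2 * (n + 1) + 40
        \<le> (100 * (L + 2) * (M + 2)\<^sup>2 * (n + 1) + 40) * P"
      by (simp add: P_def)
    moreover have "(100 * (L + 2) * (M + 2)\<^sup>2 * (n + 1) + 40) * P
        + 50 * (L + 2) * (M + 2)\<^sup>2 * (n + 1) * P \<le> Z"
      unfolding Z_def by (simp add: power2_eq_square algebra_simps)
    ultimately show ?thesis by (simp add: algebra_simps)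
  qed
  \<comment> \<open>Inflating \<open>Z\<close> to \<open>?T\<close> makes the sum a multiple of
    \<open>P + 1\<close>.\<close>
  also have "\<dots> \<le> Z * (P + 1) ^ D + P * ?T"
    by (simp add: P_def)
  also have "\<dots> = Z * (P + 1) ^ Suc D"
    by (simp add: algebra_simps)
  finally have le: "100 * (D + 3) * (M + 2)\<^sup>2 * (n + 1)
      + length (pivots (unit_vec (Suc D)) R) * (?W + ?T) + 40 \<le> Z * (P + 1) ^ Suc D" .
  show ?case
    apply (rule callsI, rule bodies)
       apply (simp only: u bc enc_point_simps node_body_def)
       apply (rule evals_rules piv[unfolded u bc enc_point_simps]
         branch[unfolded u bc enc_point_simps] | (simp; fail))+
    using le Suc.prems(2) by (simp_all add: algebra_simps u bc)?
qed

end

section \<open>Running time\<close>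

lemma length_vec: "length p = d \<Longrightarrow> length (vec p l j base) = j * (d + 1) + length base"
  by (induction j) auto

text \<open>The label \<open>l\<close> matches none of the \<open>j\<close> blocks, so all of them
  vanish. The base \<open>[0, 1]\<close> ignores the homogenizing variable and sets the constant
  term to one.\<close>

lemma vec_unit:
  assumes "length p = d" "j \<le> l"
  shows "vec p l j [0, 1] = unit_vec (j * (d + 1) + 1)"
proof -
  have z: "map (\<lambda>x. x * 0) p = replicate d (0::real)"
    using assms(1) by (simp add: map_replicate_const)
  have "vec p l j [0, 1] = replicate (j * (d + 1)) 0 @ [0, 1]"
    using assms(2)
  proof (induction j)
    case (Suc j)
    have "replicate (Suc j * (d + 1)) (0::real)
        = replicate d 0 @ [0] @ replicate (j * (d + 1)) 0"
      by (simp add: replicate_add[symmetric] flip: replicate_Suc)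
    then show ?case using Suc z by simp
  qed simp
  also have "\<dots> = unit_vec (j * (d + 1) + 1)"
    by (simp add: unit_vec_def replicate_append_same[symmetric] del: replicate.simps)
      (simp add: replicate_append_same)
  finally show ?thesis .
qed

lemma set_point_items:
  "set (point_items p w k j) = (\<lambda>l. ((real l # p, w), vec p l k [sumsq p, 0])) ` {..<j}"
  by (induction j) (auto simp: lessThan_Suc)

lemma length_point_items: "length (point_items p w k j) = j"
  by (induction j) auto

lemma set_items:
  "set (items k x) = (\<Union>p\<in>set (fst x). \<Union>l<k. {((real l # p, snd x), vec p l k [sumsq p, 0])})"
  by (auto simp: items_def set_point_items)

lemma row_shape_items:
  assumes "length (fst x) = m" "\<forall>p\<in>set (fst x). length p = d"
  shows "row_shape (m * k) (k * (d + 1) + 1) (items k x)"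
proof -
  have "length (items k x) = length (fst x) * k"
    by (simp add: items_def length_concat o_def length_point_items sum_list_triv)
  then show ?thesis
    using assms by (auto simp: row_shape_def set_items length_vec)
qed

text \<open>The pivot \<open>[1]\<close> is always available. Hence \<open>best\<close> is applied
  to a nonempty list.\<close>

lemma enum_ne: "enum D R \<noteq> []"
proof (induction D arbitrary: R)
  case (Suc D)
  have "pivots (unit_vec (Suc D)) R \<noteq> []" by (simp add: pivots_def)
  then show ?case using Suc by auto
qed simp

text \<open>Elimination rewrites the functionals and leaves the labels alone. Every leaf, consistent
  or not, thus picks for each input set one of its points and a center.\<close>

lemma enum_tags:
  "\<forall>r\<in>set R. r \<noteq> [] \<Longrightarrow> a \<in> set (enum D R) \<Longrightarrow> list_all2 (\<lambda>r x. x \<in> fst ` set r) R a"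
proof (induction D arbitrary: R)
  case 0
  then show ?case
    using amin_in_set by (auto simp: leaf_def list_all2_conv_all_nth)
next
  case (Suc D)
  then obtain f where "a \<in> set (enum D (map (map (elim f)) R))" by auto
  then have "list_all2 (\<lambda>r x. x \<in> fst ` set r) (map (map (elim f)) R) a"
    using Suc by auto
  then show ?case
    by (simp add: list.rel_map image_image elim_def)
qed

text \<open>The first four summands of the bound pay for \<open>f_rows\<close>,
  \<open>f_vec\<close>, \<open>f_node\<close> and \<open>f_best\<close>, in this order.\<close>

lemma general_calls:
  fixes \<phi> :: "real \<Rightarrow> real" and A :: solver and \<omega> :: "nat \<Rightarrow> real"
  defines "D \<equiv> \<lambda>d k. k * (d + 1) + 1"
  assumes d: "0 < d" and m: "0 < m" and k: "0 < k" and Ws: "Ws \<noteq> []" and n: "length Ws = n"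
    and dim: "\<forall>x\<in>set Ws. length (fst x) = m \<and> (\<forall>p\<in>set (fst x). length p = d)"
    and good: "\<forall>a\<in>set (enum (D d k) (map (items k) Ws)). good_solver A \<omega> d \<delta> t a"
  shows "\<exists>j. calls \<phi> A \<omega> f_general [enc_weighted_sets Ws, Atom (real k), Atom \<delta>] 0
    (enc_list enc_point (snd (best \<phi> A \<omega> \<delta> k (enum (D d k) (map (items k) Ws)) 0)))
    (200 * (d + 1) * (k + 2) * (k + 2) * (m + 2) * (n + 1) + 100 * (d + 1) * (k + 1)
      + (n * (m * k)\<^sup>2 + 1) * (200 * (D d k + 3) * (m * k + 2)\<^sup>2 * (n + 1))
        * (n * (m * k)\<^sup>2 + 1 + 1) ^ D d k
      + (n * (m * k)\<^sup>2 + 1) ^ D d k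
        * ((k + 1) * (1000 * (d + 2) * (n + 2)\<^sup>2 + 1000 * (d + 1) * (k + 1) + t) + 50)
      + 50) j"
proof -
  define R where "R = map (items k) Ws"
  define dim where "dim = D d k"
  define as where "as = enum dim R"
  have dim_eq: "dim = k * (d + 1) + 1" by (simp add: dim_def D_def)
  obtain x Ws' where W: "Ws = x # Ws'" using Ws by (cases Ws) auto
  obtain p ps where p: "fst x = p # ps" using dim m W by (cases "fst x") auto
  have pd: "length p = d" using dim W p by auto
  have shape: "\<forall>r\<in>set R. row_shape (m * k) dim r"
    using dim row_shape_items unfolding D_def dim_def R_def by auto
  then have ne: "\<forall>r\<in>set R. r \<noteq> []"
    using m k by (auto simp: row_shape_def)
  have lR: "length R = n" using n by (simp add: R_def)
  have len: "length a = n" if "a \<in> set as" for a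
    using enum_tags[OF ne that[unfolded as_def]] lR by (auto dest: list_all2_lengthD)
  have "length as \<le> (n * (m * k)\<^sup>2 + 1) ^ dim"
    using length_enum[OF shape] lR as_def by simp
  then have as: "length as * ((k + 1) * (1000 * (d + 2) * (n + 2)\<^sup>2 + 1000 * (d + 1) * (k + 1) + t) + 50)
     \<le> (n * (m * k)\<^sup>2 + 1) ^ dim
        * ((k + 1) * (1000 * (d + 2) * (n + 2)\<^sup>2 + 1000 * (d + 1) * (k + 1) + t) + 50)"
    by (rule mult_right_mono) simp
  have mk: "0 < m * k" using m k by simp
  note v = vec_calls[where j = k and l = k and base = "[0, 1]", OF pd refl refl,
      unfolded vec_unit[OF pd order_refl] enc_point_simps, folded dim_eq]
  have node: "calls \<phi> A \<omega> f_node
      [enc_list (enc_list enc_item) R, enc_point (unit_vec dim), Nul] i (enc_list (enc_list enc_tag) as)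
      ((n * (m * k)\<^sup>2 + 1) * (200 * (dim + 3) * (m * k + 2)\<^sup>2 * (n + 1))
        * (n * (m * k)\<^sup>2 + 1 + 1) ^ dim) i" for i
    using node_calls[OF mk shape lR order_refl, of \<phi> A \<omega> "[]" i] by (simp add: as_def)
  have rows: "calls \<phi> A \<omega> f_rows
     [Cell (Cell (Cell (enc_point p) (enc_list enc_point ps)) (Atom (snd x))) (enc_list enc_wset Ws'),
      Atom (real k)] i (enc_list (enc_list enc_item) R)
     (200 * (d + 1) * (k + 2) * (k + 2) * (m + 2) * (n + 1)) i" for i
    using rows_calls[OF dim, of \<phi> A \<omega> k i, folded R_def, unfolded n]
    by (simp add: W p enc_wset_def[of x])
  have "as \<noteq> []" using enum_ne by (simp add: as_def)
  moreover have "\<forall>a\<in>set as. good_solver A \<omega> d \<delta> t a \<and> length a = n"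
    using good len by (simp add: as_def R_def dim_def)
  ultimately have best: "calls \<phi> A \<omega> f_best [enc_list (enc_list enc_tag) as, Atom (real k), Atom \<delta>] i
      (Cell (Atom (fst (best \<phi> A \<omega> \<delta> k as i))) (enc_list enc_point (snd (best \<phi> A \<omega> \<delta> k as i))))
      ((n * (m * k)\<^sup>2 + 1) ^ dim
        * ((k + 1) * (1000 * (d + 2) * (n + 2)\<^sup>2 + 1000 * (d + 1) * (k + 1) + t) + 50))
      (i + length as * k)" for i
    by (intro calls_mono[OF best_calls[OF d] refl as refl])
  show ?thesis
    unfolding R_def[symmetric] dim_def[symmetric] as_def[symmetric]
    apply (rule exI)
    apply (rule callsI, rule bodies)
       apply (simp only: enc_weighted_sets_eq enc_list.simps W enc_wset_def[of x] p general_body_def)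
       apply (rule evals_rules rows v node best)+
      apply (rule refl, linarith, rule refl)
    done
qed

text \<open>Every quantity is compared with \<open>E = N ^ (d * k)\<close> for
  \<open>N = n * m * k\<close>. Because \<open>2 <= N\<close>, both \<open>d * k\<close> and
  \<open>N\<close> are at most \<open>E\<close>, and the depth \<open>k * (d + 1) + 1\<close> is at
  most \<open>3 * (d * k)\<close>. All terms become polynomials in \<open>E\<close> of degree at
  most 16, up to the factor \<open>t\<close>, far below the claimed constants. The summand 100
  leaves room for the case distinction in \<open>main_body\<close>.\<close>

lemma time_bound:
  fixes n m k d t :: nat
  assumes N: "2 \<le> n * m * k" and d: "1 \<le> d" and t: "1 \<le> t"
  shows "200 * (d + 1) * (k + 2) * (k + 2) * (m + 2) * (n + 1) + 100 * (d + 1) * (k + 1)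
      + (n * (m * k)\<^sup>2 + 1) * (200 * (k * (d + 1) + 1 + 3) * (m * k + 2)\<^sup>2 * (n + 1))
        * (n * (m * k)\<^sup>2 + 1 + 1) ^ (k * (d + 1) + 1)
      + (n * (m * k)\<^sup>2 + 1) ^ (k * (d + 1) + 1)
        * ((k + 1) * (1000 * (d + 2) * (n + 2)\<^sup>2 + 1000 * (d + 1) * (k + 1) + t) + 50)
      + 50 + 100 \<le> 1000000 * t * (n * m * k) ^ (1000000 * d * k)"
proof -
  define N where "N = n * m * k"
  define E where "E = N ^ (d * k)"
  let ?P = "n * (m * k)\<^sup>2 + 1" and ?D = "k * (d + 1) + 1"
  have pos: "1 \<le> n" "1 \<le> m" "1 \<le> k" using N by (auto intro!: Suc_leI gr0I)
  have N2: "2 \<le> N" using N by (simp add: N_def)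
  have dk: "1 \<le> d * k" using pos d by simp
  have "d * k < 2 ^ (d * k)" by (rule less_exp)
  also have "2 ^ (d * k) \<le> E" unfolding E_def using N2 by (rule power_mono) simp
  finally have dkE: "d * k < E" .
  have "N ^ 1 \<le> E" unfolding E_def using N2 dk by (intro power_increasing) auto
  then have NE: "N \<le> E" by simp
  have E2: "2 \<le> E" using NE N2 by simp
  have dE: "d \<le> E" and kE: "k \<le> E"
    using dkE mult_le_mono[OF order_refl pos(3), of d] mult_le_mono[OF d order_refl, of k]
    by linarith+
  have mkN: "m * k \<le> N" "n \<le> N" "m \<le> N"
    using pos mult_le_mono[of 1 n "m * k" "m * k"] mult_le_mono[of n n 1 "m * k"]
      mult_le_mono[of m "m * k" 1 n]
    by (auto simp: N_def mult_ac)
  \<comment> \<open>The exponent 3 absorbs the additive constant: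
    \<open>N^2 + 2 <= 2 * N^2 <= N^3\<close>.\<close>
  have PN: "?P + 1 \<le> N ^ 3"
  proof -
    have "n * (m * k)\<^sup>2 \<le> n * n * (m * k)\<^sup>2"
      using pos by (intro mult_right_mono) auto
    also have "\<dots> = N\<^sup>2" by (simp add: N_def power2_eq_square mult_ac)
    finally have a: "n * (m * k)\<^sup>2 \<le> N\<^sup>2" .
    have "2 * 2 \<le> N * N" using N2 by (intro mult_le_mono) auto
    moreover have "2 * (N * N) \<le> N * (N * N)" using N2 by (intro mult_le_mono) auto
    ultimately show ?thesis
      using a unfolding power2_eq_square power3_eq_cube mult.assoc by linarith
  qed
  have PE: "?P \<le> E ^ 3"
    using PN power_mono[OF NE, of 3] by linarith
  have PD: "(?P + 1) ^ ?D \<le> E ^ 9"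
  proof -
    have "(?P + 1) ^ ?D \<le> (N ^ 3) ^ ?D" using PN by (rule power_mono) simp
    also have "\<dots> = N ^ (3 * ?D)" by (simp only: power_mult)
    also have "\<dots> \<le> N ^ (9 * (d * k))"
    proof (rule power_increasing)
      have "k \<le> d * k" using d by simp
      moreover have "3 * ?D = 3 * (d * k) + 3 * k + 3" by (simp add: algebra_simps)
      ultimately show "3 * ?D \<le> 9 * (d * k)" using dk by linarith
    qed (use N2 in simp)
    also have "\<dots> = E ^ 9" unfolding E_def by (simp only: power_mult[symmetric] mult.commute)
    finally show ?thesis .
  qed
  have PD': "?P ^ ?D \<le> E ^ 9"
    using PD power_mono[of ?P "?P + 1" ?D] by linarith
  have DE: "?D + 3 \<le> 6 * E"
  proof -
    have "k * (d + 1) = d * k + k" by simp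
    then show ?thesis using dkE kE E2 by linarith
  qed
  have Epow: "E ^ i \<le> E ^ j" if "i \<le> j" for i j
    using that E2 by (intro power_increasing) auto
  have b: "d + 1 \<le> 2 * E" "k + 2 \<le> 2 * E" "m + 2 \<le> 2 * E" "n + 1 \<le> 2 * E" "k + 1 \<le> 2 * E"
    "m * k + 2 \<le> 2 * E" "d + 2 \<le> 2 * E" "n + 2 \<le> 2 * E"
    using dE kE mkN NE E2 by linarith+
  have t1: "200 * (d + 1) * (k + 2) * (k + 2) * (m + 2) * (n + 1)
      \<le> 200 * (2 * E) * (2 * E) * (2 * E) * (2 * E) * (2 * E)"
    by (intro mult_le_mono b order_refl)
  have t2: "100 * (d + 1) * (k + 1) \<le> 100 * (2 * E) * (2 * E)"
    by (intro mult_le_mono b order_refl)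
  have t3: "?P * (200 * (?D + 3) * (m * k + 2)\<^sup>2 * (n + 1)) * (?P + 1) ^ ?D
      \<le> E ^ 3 * (200 * (6 * E) * (2 * E)\<^sup>2 * (2 * E)) * E ^ 9"
    by (intro mult_le_mono b order_refl PE PD DE power_mono) simp_all
  have t4: "?P ^ ?D * ((k + 1) * (1000 * (d + 2) * (n + 2)\<^sup>2 + 1000 * (d + 1) * (k + 1) + t) + 50)
      \<le> E ^ 9 * (2 * E * (1000 * (2 * E) * (2 * E)\<^sup>2 + 1000 * (2 * E) * (2 * E) + t) + 50)"
    by (intro mult_le_mono add_mono b order_refl PD' power_mono) simp_all
  define F where "F = E ^ 16"
  have F: "E ^ i \<le> t * F" if "i \<le> 16" for i
    using Epow[OF that] mult_le_mono[OF t, of "E ^ i" "E ^ 16"] by (simp add: F_def)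
  have F1: "1 \<le> t * F" using F[of 0] by simp
  have tE: "t * E ^ 10 \<le> t * F" unfolding F_def by (intro mult_le_mono Epow) simp_all
  have s1: "200 * (2 * E) * (2 * E) * (2 * E) * (2 * E) * (2 * E) = 6400 * E ^ 5"
    by algebra
  have s2: "100 * (2 * E) * (2 * E) = 400 * E ^ 2"
    by algebra
  have s3: "E ^ 3 * (200 * (6 * E) * (2 * E)\<^sup>2 * (2 * E)) * E ^ 9 = 9600 * E ^ 16"
    by algebra
  have s4: "E ^ 9 * (2 * E * (1000 * (2 * E) * (2 * E)\<^sup>2 + 1000 * (2 * E) * (2 * E) + t) + 50)
      = 16000 * E ^ 13 + 8000 * E ^ 12 + 2 * (t * E ^ 10) + 50 * E ^ 9"
    by algebra
  have "200 * (d + 1) * (k + 2) * (k + 2) * (m + 2) * (n + 1) + 100 * (d + 1) * (k + 1)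
      + ?P * (200 * (?D + 3) * (m * k + 2)\<^sup>2 * (n + 1)) * (?P + 1) ^ ?D
      + ?P ^ ?D * ((k + 1) * (1000 * (d + 2) * (n + 2)\<^sup>2 + 1000 * (d + 1) * (k + 1) + t) + 50)
      + 50 + 100 \<le> 1000000 * (t * F)"
    using t1 t2 t3 t4 F[of 5] F[of 2] F[of 16] F[of 13] F[of 12] F[of 9] tE F1
    unfolding s1 s2 s3 s4 by linarith
  also have "\<dots> \<le> 1000000 * (t * N ^ (1000000 * d * k))"
  proof -
    have "F = N ^ (d * k * 16)" by (simp only: F_def E_def power_mult)
    also have "\<dots> \<le> N ^ (1000000 * d * k)" using N2 by (intro power_increasing) auto
    finally show ?thesis by simp
  qed
  finally show ?thesis by (simp add: N_def mult_ac)
qed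

section \<open>Completeness of the enumeration\<close>

text \<open>The inner product: the value of a functional at an assignment of its variables. An
  assignment ends with the entry 1, which picks up the constant term.\<close>

fun ev :: "real list \<Rightarrow> real list \<Rightarrow> real" where
  "ev (a # g) (b # z) = a * b + ev g z"
| "ev _ _ = 0"

lemma ev_Nil2: "ev g [] = 0"
  by (cases g) auto

lemma ev_axpy: "length u = length v \<Longrightarrow> ev (axpy s u v) z = ev v z + s * ev u z"
proof (induction u v arbitrary: z rule: list_induct2)
  case (Cons x u y v)
  then show ?case by (cases z) (auto simp: algebra_simps)
qed simp

lemma ev_append: "length g = length z \<Longrightarrow> ev (g @ g') (z @ z') = ev g z + ev g' z'"
  by (induction g z rule: list_induct2) auto

lemma ev_unit_vec: "length y = D \<Longrightarrow> ev (unit_vec D) (y @ [1]) = 1"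
proof -
  assume y: "length y = D"
  have "ev (replicate (length y) 0) y = 0" by (induction y) auto
  then show ?thesis using y by (simp add: unit_vec_def ev_append)
qed

lemma ev_hd: "g \<noteq> [] \<Longrightarrow> ev g (b # z) = hd g * b + ev (tl g) z"
  by (cases g) auto

text \<open>The margin is closed, so a constraint that has become tight still holds; with a strict
  inequality it would be lost. Items are compared by their labels because these survive
  elimination.\<close>

definition sep :: "real list \<Rightarrow> item list \<Rightarrow> item \<Rightarrow> bool" where
  "sep z r x \<longleftrightarrow> x \<in> set r \<and>
     (\<forall>v\<in>set r. fst v \<noteq> fst x \<longrightarrow> 1 \<le> ev (snd v) z - ev (snd x) z)"

lemma ex_min_on:
  fixes q :: "'a \<Rightarrow> real"
  assumes "finite S" "S \<noteq> {}"
  shows "\<exists>x\<in>S. \<forall>y\<in>S. q x \<le> q y"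
  using arg_min_if_finite(1)[OF assms, of q] arg_min_least[OF assms, of _ q] by blast

lemma amin_le: "u \<in> set us \<Longrightarrow> hd (snd (amin us)) \<le> hd (snd u)"
proof (induction us rule: amin.induct)
  case (3 v v' us)
  show ?case
  proof (cases "u = v")
    case True
    then show ?thesis by (simp add: Let_def)
  next
    case False
    then have "hd (snd (amin (v' # us))) \<le> hd (snd u)" using 3 by simp
    then show ?thesis by (simp add: Let_def)
  qed
qed simp_all

text \<open>On the zero set of the pivot the first variable is a function of the others, and
  \<open>elim\<close> substitutes this function.\<close>

lemma ev_elim:
  assumes "length (snd u) = Suc (length f)" "c \<noteq> 0" "ev (c # f) (b # z) = 0"
  shows "ev (snd (elim (c # f) u)) z = ev (snd u) (b # z)"
proof -
  obtain a g where g: "snd u = a # g" "length g = length f"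
    using assms(1) by (cases "snd u") auto
  have "ev f z = - c * b" using assms(3) by simp
  then show ?thesis using assms(2) g by (simp add: elim_def ev_axpy)
qed

text \<open>Move the current variable until the first constraint becomes tight, and eliminate the
  variable with this constraint; a variable that occurs in no constraint is set to zero.\<close>

lemma enum_complete:
  "\<forall>r\<in>set R. row_shape M D r \<Longrightarrow> length y = D \<Longrightarrow> list_all2 (sep (y @ [1])) R us \<Longrightarrow>
     map fst us \<in> set (enum D R)"
proof (induction D arbitrary: R y us)
  case 0
  \<comment> \<open>No variables are left, so the functionals are constants, and the winner is
    smaller by one than every item with another label.\<close>
  have "fst (amin r) = fst x" if "(r, x) \<in> set (zip R us)" for r x
  proof (rule ccontr)
    assume *: "fst (amin r) \<noteq> fst x"
    have s: "sep [1] r x"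
      using 0(2,3) that unfolding list_all2_iff by auto
    then have x: "x \<in> set r" by (simp add: sep_def)
    then have "r \<noteq> []" by auto
    then have m: "amin r \<in> set r" by (rule amin_in_set)
    have "r \<in> set R" using that by (rule set_zip_leftD)
    then have l: "length (snd u) = 1" if "u \<in> set r" for u
      using 0(1) that by (auto simp: row_shape_def)
    have e: "ev (snd u) [1] = hd (snd u)" if "u \<in> set r" for u
      using l[OF that] by (cases "snd u") (auto simp: ev_Nil2)
    have "1 \<le> ev (snd (amin r)) [1] - ev (snd x) [1]"
      using s m * unfolding sep_def by blast
    then have "1 \<le> hd (snd (amin r)) - hd (snd x)"
      unfolding e[OF m] e[OF x] .
    with amin_le[OF x] show False by simp
  qed
  moreover have len: "length R = length us" using 0(3) by (rule list_all2_lengthD)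
  ultimately have "fst (us ! i) = fst (amin (R ! i))" if "i < length us" for i
    using that by (metis in_set_zip fst_conv snd_conv)
  then have "map fst us = leaf R"
    using len unfolding leaf_def by (intro nth_equalityI) simp_all
  then show ?case by simp
next
  case (Suc D)
  obtain b y' where y: "y = b # y'" "length y' = D" using Suc.prems(2) by (cases y) auto
  define z where "z = y' @ [1]"
  define e where "e = unit_vec (Suc D)"
  \<comment> \<open>The constraint that \<open>v\<close> exceeds the winner \<open>x\<close> by one,
    as a functional that has to be nonnegative. The program does not know \<open>x\<close>, which is
    why \<open>pivots\<close> tries all ordered pairs.\<close>
  define con where "con x v = axpy (- 1) e (axpy (- 1) (snd x) (snd v))" for x v :: item
  define F where "F = (\<Union>rx\<in>set (zip R us).
    con (snd rx) ` {v \<in> set (fst rx). fst v \<noteq> fst (snd rx)})"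
  have len: "length R = length us" using Suc.prems(3) by (rule list_all2_lengthD)
  have sep: "sep (b # z) r x" if "(r, x) \<in> set (zip R us)" for r x
    using Suc.prems(3) that by (auto simp: list_all2_iff y z_def)
  have shape: "length (snd u) = Suc (Suc D)" if "(r, x) \<in> set (zip R us)" "u \<in> set r" for r x u
    using Suc.prems(1) set_zip_leftD[OF that(1)] that(2) by (auto simp: row_shape_def)
  have in_r: "x \<in> set r" if "(r, x) \<in> set (zip R us)" for r x
    using sep[OF that] by (simp add: sep_def)
  have le: "length e = Suc (Suc D)" by (simp add: e_def length_unit_vec)
  have ee: "ev e (c # z) = 1" for c
    using ev_unit_vec[of "c # y'" "Suc D"] y(2) by (simp add: e_def z_def)
  have ev_con: "ev (con x v) (c # z) = ev (snd v) (c # z) - ev (snd x) (c # z) - 1"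
    if "(r, x) \<in> set (zip R us)" "v \<in> set r" for r x v c
  proof -
    have "length (snd x) = length (snd v)" "length e = length (axpy (- 1) (snd x) (snd v))"
      using shape[OF that] shape[OF that(1) in_r[OF that(1)]] le by (simp_all add: length_axpy)
    then show ?thesis unfolding con_def by (simp add: ev_axpy ee)
  qed
  have FE: "\<exists>r x v. (r, x) \<in> set (zip R us) \<and> v \<in> set r \<and> fst v \<noteq> fst x \<and> f = con x v"
    if f: "f \<in> F" for f
  proof -
    obtain rx v where "rx \<in> set (zip R us)" "v \<in> set (fst rx)" "fst v \<noteq> fst (snd rx)"
      "f = con (snd rx) v"
      using f unfolding F_def by blast
    then show ?thesis by (metis prod.collapse)
  qed
  have lF: "length f = Suc (Suc D)" if "f \<in> F" for f
    using FE[OF that] shape by (auto simp: con_def length_axpy)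
  have F0: "0 \<le> ev f (b # z)" if f: "f \<in> F" for f
  proof -
    obtain r x v where *: "(r, x) \<in> set (zip R us)" "v \<in> set r" "fst v \<noteq> fst x" "f = con x v"
      using FE[OF f] by blast
    then have "1 \<le> ev (snd v) (b # z) - ev (snd x) (b # z)"
      using sep[OF *(1)] unfolding sep_def by blast
    then show ?thesis using ev_con[OF *(1,2), of b] *(4) by simp
  qed
  have finF: "finite F" unfolding F_def by auto
  have piv: "f \<in> set (pivots e R)" if f: "f \<in> F" "hd f \<noteq> 0" for f
  proof -
    obtain r x v where *: "(r, x) \<in> set (zip R us)" "v \<in> set r" "f = con x v"
      using FE[OF f(1)] by blast
    then have "f \<in> set (pivots1 e r (snd v))"
      using in_r f(2) unfolding pivots1_def con_def by auto
    then show ?thesis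
      using *(2) set_zip_leftD[OF *(1)] unfolding pivots_def by auto
  qed
  \<comment> \<open>What remains is to find a pivot \<open>f\<close> and a new value
    \<open>c\<close> of the first variable such that all constraints hold at \<open>c # z\<close>
    and eliminating with \<open>f\<close> preserves the values there.\<close>
  have step: "map fst us \<in> set (enum (Suc D) R)"
    if f: "f \<in> set (pivots e R)" and nonneg: "\<And>h. h \<in> F \<Longrightarrow> 0 \<le> ev h (c # z)"
      and el: "\<And>u. length (snd u) = Suc (Suc D) \<Longrightarrow> ev (snd (elim f u)) z = ev (snd u) (c # z)"
    for f c
  proof -
    have "sep z (map (elim f) r) (elim f x)" if rx: "(r, x) \<in> set (zip R us)" for r x
    proof -
      have "1 \<le> ev (snd (elim f v)) z - ev (snd (elim f x)) z"
        if v: "v \<in> set r" "fst v \<noteq> fst x" for v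
      proof -
        have "con x v \<in> F" using rx v unfolding F_def by force
        then have "0 \<le> ev (con x v) (c # z)" by (rule nonneg)
        then show ?thesis
          using ev_con[OF rx v(1)] el[OF shape[OF rx v(1)]] el[OF shape[OF rx in_r[OF rx]]] by simp
      qed
      then show ?thesis using in_r[OF rx] by (auto simp: sep_def elim_def)
    qed
    then have "list_all2 (sep (y' @ [1])) (map (map (elim f)) R) (map (elim f) us)"
      using len by (auto simp: list_all2_iff zip_map_map z_def)
    moreover have "\<forall>r\<in>set (map (map (elim f)) R). row_shape M D r"
      using Suc.prems(1) row_shape_elim by auto
    ultimately have "map fst (map (elim f) us) \<in> set (enum D (map (map (elim f)) R))"
      using Suc.IH y(2) by blast
    moreover have "map fst (map (elim f) us) = map fst us" by (simp add: elim_def)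
    ultimately have "map fst us \<in> set (enum D (map (map (elim f)) R))" by (simp only:)
    then show ?thesis using f unfolding e_def by auto
  qed
  show ?case
  proof (cases "\<forall>f\<in>F. hd f = 0")
    case True
    have "0 \<le> ev h (0 # z)" if "h \<in> F" for h
    proof -
      have "h \<noteq> []" "hd h = 0" using lF[OF that] True that by auto
      then show ?thesis using F0[OF that] by (simp add: ev_hd)
    qed
    moreover have "ev (snd (elim [1] u)) z = ev (snd u) (0 # z)"
      if "length (snd u) = Suc (Suc D)" for u
      using that by (cases "snd u") (auto simp: elim_def)
    ultimately show ?thesis by (intro step[of "[1]" 0]) (auto simp: pivots_def)
  next
    case False
    \<comment> \<open>A ratio test: \<open>q f\<close> is how far the first variable has to move
      until \<open>f\<close> is tight. If \<open>q f\<close> is least, a move by \<open>q f\<close>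
      changes any other constraint \<open>h\<close> by at most \<open>ev h (b # z)\<close>, whatever
      the direction, so none is violated.\<close>
    define q where "q f = ev f (b # z) / \<bar>hd f\<bar>" for f
    let ?G = "{f \<in> F. hd f \<noteq> 0}"
    have "finite ?G" "?G \<noteq> {}" using finF False by auto
    then obtain f where f: "f \<in> F" "hd f \<noteq> 0" and min: "\<And>h. h \<in> ?G \<Longrightarrow> q f \<le> q h"
      using ex_min_on[of ?G q] by blast
    obtain c f' where cf: "f = c # f'" "length f' = Suc D"
      using lF[OF f(1)] by (cases f) auto
    have c0: "c \<noteq> 0" using f(2) cf by simp
    define b' where "b' = b - ev f (b # z) / c"
    have shift: "ev h (b' # z) = ev h (b # z) - hd h * (ev f (b # z) / c)" if "h \<in> F" for h
    proof -
      have "h \<noteq> []" using lF[OF that] by auto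
      then show ?thesis by (simp add: ev_hd b'_def algebra_simps)
    qed
    have "0 \<le> ev h (b' # z)" if h: "h \<in> F" for h
    proof (cases "hd h = 0")
      case True
      then show ?thesis using shift[OF h] F0[OF h] by simp
    next
      case False
      then have "q f \<le> q h" using h min by auto
      then have "\<bar>hd h\<bar> * q f \<le> ev h (b # z)"
        using False unfolding q_def[of h] by (simp add: field_simps)
      moreover have "\<bar>hd h * (ev f (b # z) / c)\<bar> = \<bar>hd h\<bar> * q f"
        using F0[OF f(1)] by (simp add: q_def cf abs_mult)
      ultimately show ?thesis using shift[OF h] by linarith
    qed
    moreover have "ev (c # f') (b' # z) = 0"
      using shift[OF f(1)] c0 by (simp add: cf)
    ultimately show ?thesis
      using ev_elim[of _ f' c b' z] c0 cf piv[OF f] by (intro step[of f b']) auto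
  qed
qed

section \<open>Lifted centers and their functionals\<close>

fun lifted :: "(nat \<Rightarrow> point) \<Rightarrow> nat \<Rightarrow> real list" where
  "lifted C 0 = []"
| "lifted C (Suc j) = map ((*) (- 2)) (C j) @ sumsq (C j) # lifted C j"

lemma length_lifted: "\<forall>j<k. length (C j) = d \<Longrightarrow> length (lifted C k) = k * (d + 1)"
  by (induction k) auto

lemma sqdist_lifted:
  "length p = length c \<Longrightarrow> sqdist p c = ev p (map ((*) (- 2)) c) + sumsq c + sumsq p"
proof (induction p c rule: list_induct2)
  case Nil
  then show ?case by (simp add: sqdist_def sumsq_def)
next
  case (Cons x p y c)
  then show ?case
    by (simp add: sqdist_Cons sumsq_def power2_eq_square algebra_simps)
qed

text \<open>\<open>vec\<close> and \<open>lifted\<close> both start with the block of largest index,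
  so their blocks are aligned and only the block of the label contributes.\<close>

lemma ev_vec:
  assumes "length p = d"
  shows "\<forall>i<j. length (C i) = d \<Longrightarrow> ev (vec p l j g) (lifted C j @ z) =
    (if l < j then ev p (map ((*) (- 2)) (C l)) + sumsq (C l) else 0) + ev g z"
proof (induction j)
  case (Suc j)
  have z: "ev (map (\<lambda>x. 0) p) q = 0" for q
  proof (induction p arbitrary: q)
    case (Cons a p)
    then show ?case by (cases q) auto
  qed simp
  show ?case
    using Suc assms by (auto simp: ev_append z less_Suc_eq)
qed simp

lemma vec_append: "vec p l j (g @ g') = vec p l j g @ g'"
  by (induction j) auto

text \<open>The entry 1 at the end of a block reveals the label, and the entries before it are the
  point. Different pairs thus have different functionals, which a generic point can tell
  apart.\<close>

lemma vec_inj: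
  assumes "length p = d" "length p' = d"
  shows "l < j \<Longrightarrow> l' < j \<Longrightarrow> vec p l j g = vec p' l' j g' \<Longrightarrow> l = l' \<and> p = p'"
  using assms by (induction j) (auto simp: less_Suc_eq)

section \<open>Generic perturbation by a point of the moment curve\<close>

lemma ev_powers:
  "ev g (map (\<lambda>i. x ^ i) [0..<length g]) = poly (Poly g) x"
proof (induction g)
  case (Cons a g)
  have s: "ev g (map (\<lambda>t. x * t) z) = x * ev g z" for z
  proof (induction g arbitrary: z)
    case (Cons a g)
    then show ?case by (cases z) (auto simp: algebra_simps)
  qed simp
  have "map (\<lambda>i. x ^ i) [0..<length (a # g)] = 1 # map (\<lambda>t. x * t) (map (\<lambda>i. x ^ i) [0..<length g])"
    by (simp add: upt_conv_Cons map_Suc_upt[symmetric] o_def del: upt_Suc)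
  moreover have "ev (a # g) (1 # map (\<lambda>t. x * t) z) = a + x * ev g z" for z
    by (simp add: s)
  ultimately show ?case by (simp only: Cons.IH Poly.simps poly_pCons)
qed simp

text \<open>\<open>Poly\<close> forgets trailing zeros, hence the condition on the lengths.\<close>

lemma Poly_inj: "length g = length h \<Longrightarrow> Poly g = Poly h \<Longrightarrow> g = h"
  by (rule nth_equalityI) (simp, metis coeff_Poly_eq nth_default_nth)

text \<open>At a point of the moment curve a functional is evaluated as a polynomial. Two different
  functionals agree only at the roots of a nonzero polynomial, so finitely many parameters
  \<open>x\<close> are bad.\<close>

lemma ex_separating_point:
  assumes "finite U" "\<forall>g\<in>U. length g = (D::nat)"
  shows "\<exists>z. length z = D \<and> inj_on (\<lambda>g. ev g z) U"
proof -
  define Z where "Z = (\<Union>(g, h)\<in>{(g, h) \<in> U \<times> U. g \<noteq> h}. {x. poly (Poly g - Poly h) x = 0})"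
  have fin: "finite {x. poly (Poly g - Poly h) x = 0}" if "g \<in> U" "h \<in> U" "g \<noteq> h" for g h
  proof (rule poly_roots_finite)
    show "Poly g - Poly h \<noteq> 0"
      using that assms(2) Poly_inj[of g h] by (metis eq_iff_diff_eq_0)
  qed
  have "finite {(g, h) \<in> U \<times> U. g \<noteq> h}"
    by (rule finite_subset[of _ "U \<times> U"]) (use assms(1) in auto)
  then have "finite Z"
    unfolding Z_def using fin by (intro finite_UN_I) auto
  then obtain x where x: "x \<notin> Z"
    using ex_new_if_finite[OF infinite_UNIV_char_0] by blast
  have "inj_on (\<lambda>g. ev g (map (\<lambda>i. x ^ i) [0..<D])) U"
  proof (rule inj_onI, rule ccontr)
    fix g h assume gh: "g \<in> U" "h \<in> U" "g \<noteq> h"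
      "ev g (map (\<lambda>i. x ^ i) [0..<D]) = ev h (map (\<lambda>i. x ^ i) [0..<D])"
    then have "poly (Poly g) x = poly (Poly h) x"
      using assms(2) ev_powers[of g x] ev_powers[of h x] by auto
    then show False using x gh(1-3) unfolding Z_def by auto
  qed
  then show ?thesis by (intro exI[of _ "map (\<lambda>i. x ^ i) [0..<D]"]) auto
qed

lemma ev_lin:
  "length y = length v \<Longrightarrow>
    ev g (map2 (\<lambda>a b. s * a + t * b) y v) = s * ev g y + t * ev g v"
proof (induction y v arbitrary: g rule: list_induct2)
  case (Cons a y b v)
  then show ?case by (cases g) (auto simp: algebra_simps)
qed (simp add: ev_Nil2)

text \<open>The weights \<open>s^2\<close> and \<open>s\<close> turn lexicographic positivity into
  numerical positivity: \<open>a\<close> dominates, and if \<open>a = 0\<close> the tie-breaking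
  term still grows beyond one.\<close>

lemma eventually_gap:
  fixes a b :: real
  assumes "0 < a \<or> a = 0 \<and> 0 < b"
  shows "eventually (\<lambda>s. 1 \<le> s\<^sup>2 * a + s * b) at_top"
proof (cases "a = 0")
  case True
  have "1 \<le> s * b" if "1 / b \<le> s" for s
    using that assms True by (simp add: field_simps)
  then show ?thesis using True by (auto simp: eventually_at_top_linorder)
next
  case False
  then have a: "0 < a" using assms by simp
  have "1 \<le> s\<^sup>2 * a + s * b" if s: "max 1 ((1 - b) / a) \<le> s" for s
  proof -
    have "1 \<le> s" "1 \<le> s * a + b" using s a by (auto simp: field_simps)
    then have "1 * 1 \<le> s * (s * a + b)" by (intro mult_mono) auto
    then show ?thesis by (simp add: power2_eq_square algebra_simps)
  qed
  then show ?thesis unfolding eventually_at_top_linorder by blast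
qed

text \<open>Ties between distances are broken by the dominated generic point \<open>v\<close>.\<close>

lemma ex_strict_point:
  assumes U: "finite U" "\<forall>g\<in>U. length g = D" and y0: "length y0 = D"
  shows "\<exists>y. length y = D \<and> (\<forall>g\<in>U. \<forall>h\<in>U. g \<noteq> h \<longrightarrow>
    (1 \<le> ev h y - ev g y \<and> ev g y0 \<le> ev h y0) \<or> (1 \<le> ev g y - ev h y \<and> ev h y0 \<le> ev g y0))"
proof -
  obtain v where v: "length v = D" "inj_on (\<lambda>g. ev g v) U"
    using ex_separating_point[OF U] by blast
  \<comment> \<open>The lexicographic order by the values at \<open>y0\<close> and then at
    \<open>v\<close>. It is total on \<open>U\<close> because \<open>v\<close> separates, and
    finitely many pairs allow one common \<open>s\<close>.\<close>
  define lt where "lt g h \<longleftrightarrow> 0 < ev h y0 - ev g y0 \<or> ev h y0 - ev g y0 = 0 \<and> 0 < ev h v - ev g v"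
    for g h
  let ?gap = "\<lambda>s g h. 1 \<le> s\<^sup>2 * (ev h y0 - ev g y0) + s * (ev h v - ev g v)"
  have "finite {gh \<in> U \<times> U. lt (fst gh) (snd gh)}" using U(1) by simp
  then have "eventually (\<lambda>s. \<forall>gh\<in>{gh \<in> U \<times> U. lt (fst gh) (snd gh)}. ?gap s (fst gh) (snd gh)) at_top"
    by (rule eventually_ball_finite) (auto intro!: eventually_gap simp: lt_def)
  then obtain s where s: "\<forall>gh\<in>{gh \<in> U \<times> U. lt (fst gh) (snd gh)}. ?gap s (fst gh) (snd gh)"
    unfolding eventually_at_top_linorder by blast
  let ?y = "map2 (\<lambda>a b. s\<^sup>2 * a + s * b) y0 v"
  have e: "ev g ?y = s\<^sup>2 * ev g y0 + s * ev g v" for g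
    using y0 v(1) by (intro ev_lin) simp
  have gap: "1 \<le> ev h ?y - ev g ?y \<and> ev g y0 \<le> ev h y0" if "g \<in> U" "h \<in> U" "lt g h" for g h
  proof -
    have "?gap s g h" using bspec[OF s, of "(g, h)"] that by simp
    then show ?thesis using that(3) unfolding e lt_def by (auto simp: algebra_simps)
  qed
  have total: "lt g h \<or> lt h g" if "g \<in> U" "h \<in> U" "g \<noteq> h" for g h
  proof -
    have "ev g v \<noteq> ev h v" using that inj_onD[OF v(2)] by blast
    then show ?thesis unfolding lt_def by linarith
  qed
  show ?thesis
  proof (intro exI[of _ ?y] conjI ballI impI)
    show "length ?y = D" using y0 v(1) by simp
  qed (use gap total in blast)
qed

text \<open>The perturbed point only refines the order of the squared distances, so its strict
  winner in each input set is a nearest pair for the given centers, and \<open>enum_complete\<close>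
  finds these winners.\<close>

lemma enum_nearest:
  assumes C: "\<forall>j<k. length (C j) = d" and k: "0 < k" and m: "0 < m"
    and dim: "\<forall>x\<in>set Ws. length (fst x) = m \<and> (\<forall>p\<in>set (fst x). length p = d)"
  shows "\<exists>a\<in>set (enum (k * (d + 1) + 1) (map (items k) Ws)).
    list_all2 (\<lambda>x t. \<exists>l<k. \<exists>p\<in>set (fst x). t = (real l # p, snd x) \<and>
      (\<forall>p'\<in>set (fst x). \<forall>l'<k. sqdist p (C l) \<le> sqdist p' (C l'))) Ws a"
proof -
  let ?D = "k * (d + 1) + 1"
  let ?g = "\<lambda>l p. vec p l k [sumsq p]"
  define U where "U = (\<Union>x\<in>set Ws. \<Union>p\<in>set (fst x). \<Union>l<k. {?g l p})"
  \<comment> \<open>The final 1 is the homogenizing variable, whose coefficient is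
    \<open>sumsq p\<close>. In the scaled and perturbed \<open>y\<close> it is free to have another
    value.\<close>
  define y0 where "y0 = lifted C k @ [1]"
  have lU: "\<forall>g\<in>U. length g = ?D"
    using dim by (auto simp: U_def length_vec)
  have ly0: "length y0 = ?D" using length_lifted[OF C] by (simp add: y0_def)
  have "finite U" by (simp add: U_def)
  then obtain y where y: "length y = ?D" and gap: "\<And>g h. g \<in> U \<Longrightarrow> h \<in> U \<Longrightarrow> g \<noteq> h \<Longrightarrow>
    (1 \<le> ev h y - ev g y \<and> ev g y0 \<le> ev h y0) \<or> (1 \<le> ev g y - ev h y \<and> ev h y0 \<le> ev g y0)"
    using ex_strict_point[OF _ lU ly0] by blast
  have ev_y0: "ev (?g l p) y0 = sqdist p (C l)" if "l < k" "length p = d" for l p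
    using that C ev_vec[OF that(2), of k C l "[sumsq p]" "[1]"] sqdist_lifted[of p "C l"]
    by (auto simp: y0_def)
  have ev_y: "ev (vec p l k [sumsq p, 0]) (y @ [1]) = ev (?g l p) y" if "length p = d" for l p
    using vec_append[of p l k "[sumsq p]" "[0]"] that y
    by (simp add: ev_append length_vec)
  have "\<exists>x. sep (y @ [1]) (items k w) x \<and> (\<exists>l<k. \<exists>p\<in>set (fst w). fst x = (real l # p, snd w) \<and>
      (\<forall>p'\<in>set (fst w). \<forall>l'<k. sqdist p (C l) \<le> sqdist p' (C l')))"
    if w: "w \<in> set Ws" for w
  proof -
    have dimw: "length p = d" if "p \<in> set (fst w)" for p using dim w that by auto
    have inU: "?g l p \<in> U" if "l < k" "p \<in> set (fst w)" for l p
      using that w unfolding U_def by blast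
    let ?I = "{..<k} \<times> set (fst w)"
    have "fst w \<noteq> []" using dim w m by auto
    then have "finite ?I" "?I \<noteq> {}" using k by auto
    then obtain lp where lp: "lp \<in> ?I"
      and lpmin: "\<And>i. i \<in> ?I \<Longrightarrow> ev (?g (fst lp) (snd lp)) y \<le> ev (?g (fst i) (snd i)) y"
      using ex_min_on[of ?I "\<lambda>i. ev (?g (fst i) (snd i)) y"] by blast
    obtain l p where lpe: "lp = (l, p)" by (cases lp)
    have l: "l < k" and p: "p \<in> set (fst w)" using lp lpe by auto
    have min: "ev (?g l p) y \<le> ev (?g l' p') y" if "l' < k" "p' \<in> set (fst w)" for l' p'
      using lpmin[of "(l', p')"] that lpe by simp
    \<comment> \<open>Minimality at \<open>y\<close> excludes the second alternative of
      \<open>gap\<close>. The first one also contains the comparison at \<open>y0\<close>, that is,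
      of the distances.\<close>
    have far: "1 \<le> ev (?g l' p') y - ev (?g l p) y \<and> ev (?g l p) y0 \<le> ev (?g l' p') y0"
      if "l' < k" "p' \<in> set (fst w)" "(l', p') \<noteq> (l, p)" for l' p'
    proof -
      have "?g l p \<noteq> ?g l' p'"
        using vec_inj[OF dimw[OF p] dimw[OF that(2)] l that(1)] that(3) by blast
      then show ?thesis
        using gap[OF inU[OF l p] inU[OF that(1,2)]] min[OF that(1,2)] by linarith
    qed
    let ?x = "((real l # p, snd w), vec p l k [sumsq p, 0])"
    have "sep (y @ [1]) (items k w) ?x"
      unfolding sep_def
    proof (intro conjI ballI impI)
      show "?x \<in> set (items k w)" using l p by (auto simp: set_items)
      fix v assume v: "v \<in> set (items k w)" "fst v \<noteq> fst ?x"
      then obtain l' p' where v': "v = ((real l' # p', snd w), vec p' l' k [sumsq p', 0])"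
        "l' < k" "p' \<in> set (fst w)" by (auto simp: set_items)
      then have "(l', p') \<noteq> (l, p)" using v(2) by auto
      then show "1 \<le> ev (snd v) (y @ [1]) - ev (snd ?x) (y @ [1])"
        using far[OF v'(2,3)] ev_y[OF dimw[OF p]] ev_y[OF dimw[OF v'(3)]] by (simp add: v'(1))
    qed
    moreover have "sqdist p (C l) \<le> sqdist p' (C l')" if "l' < k" "p' \<in> set (fst w)" for l' p'
    proof (cases "(l', p') = (l, p)")
      case False
      then show ?thesis
        using far[OF that False] ev_y0[OF l dimw[OF p]] ev_y0[OF that(1) dimw[OF that(2)]] by simp
    qed simp
    ultimately show ?thesis using l p by (intro exI[of _ ?x]) auto
  qed
  then obtain f where f: "\<And>w. w \<in> set Ws \<Longrightarrow> sep (y @ [1]) (items k w) (f w) \<and>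
      (\<exists>l<k. \<exists>p\<in>set (fst w). fst (f w) = (real l # p, snd w) \<and>
      (\<forall>p'\<in>set (fst w). \<forall>l'<k. sqdist p (C l) \<le> sqdist p' (C l')))"
    by metis
  have "list_all2 (sep (y @ [1])) (map (items k) Ws) (map f Ws)"
    using f by (simp add: list.rel_map list.rel_refl_strong)
  moreover have "\<forall>r\<in>set (map (items k) Ws). row_shape (m * k) ?D r"
    using dim row_shape_items by auto
  ultimately have "map fst (map f Ws) \<in> set (enum ?D (map (items k) Ws))"
    using enum_complete y by blast
  then show ?thesis
    by (rule bexI[rotated]) (use f in \<open>simp add: list.rel_map list.rel_refl_strong\<close>)
qed

section \<open>Costs and success probability\<close>

lemma edist_eq: "length p = length c \<Longrightarrow> edist p c = sqrt (sqdist p c)"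
proof -
  assume "length p = length c"
  then have "(\<Sum>i<length p. (p ! i - c ! i)\<^sup>2) = sqdist p c"
  proof (induction p c rule: list_induct2)
    case Nil
    then show ?case by (simp add: sqdist_def sumsq_def)
  next
    case (Cons x p y c)
    then show ?case by (simp add: sqdist_Cons sum.lessThan_Suc_shift del: sum.lessThan_Suc)
  qed
  then show ?thesis by (simp add: edist_def L2_set_def)
qed

lemma edist_nonneg: "0 \<le> edist p c"
  by (simp add: edist_def L2_set_nonneg)

lemma set_loss_le:
  "finite P \<Longrightarrow> finite C \<Longrightarrow> p \<in> P \<Longrightarrow> c \<in> C \<Longrightarrow> set_loss \<phi> P C \<le> \<phi> (edist p c)"
  unfolding set_loss_def by (intro Min_le) auto

lemma set_loss_eq:
  assumes "finite P" "finite C" "p \<in> P" "c \<in> C" and \<phi>: "mono_on {0..} \<phi>"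
    and min: "\<And>p' c'. p' \<in> P \<Longrightarrow> c' \<in> C \<Longrightarrow> edist p c \<le> edist p' c'"
  shows "set_loss \<phi> P C = \<phi> (edist p c)"
  unfolding set_loss_def
proof (rule Min_eqI)
  fix y assume "y \<in> (\<lambda>(p, c). \<phi> (edist p c)) ` (P \<times> C)"
  then show "\<phi> (edist p c) \<le> y"
    using min edist_nonneg by (auto intro!: mono_onD[OF \<phi>])
qed (use assms in auto)

lemma set_loss_single: "set_loss \<phi> {q} {c} = \<phi> (edist q c)"
  by (simp add: set_loss_def)

lemma pcost_weigh:
  assumes "distinct Q" "\<forall>q\<in>set Q. length q = d" "length c = d"
  shows "pcost \<phi> (weigh a j Q) c = point_cost \<phi> (\<lambda>q. wsum a (real j # q)) (set Q) c"
proof -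
  have "pcost \<phi> (weigh a j Q) c = (\<Sum>q\<leftarrow>Q. wsum a (real j # q) * \<phi> (sqrt (sqdist q c)))"
    by (simp add: pcost_def weigh_def o_def)
  also have "\<dots> = (\<Sum>q\<in>set Q. wsum a (real j # q) * \<phi> (sqrt (sqdist q c)))"
    using assms(1) by (simp add: sum_list_distinct_conv_sum_set)
  also have "\<dots> = point_cost \<phi> (\<lambda>q. wsum a (real j # q)) (set Q) c"
    unfolding point_cost_def using assms(2,3)
    by (intro sum.cong) (auto simp: set_loss_single edist_eq)
  finally show ?thesis .
qed

section \<open>Regrouping the cost by centers\<close>

definition label :: "nat \<times> point \<times> real \<Rightarrow> point \<times> real" where
  "label b = (real (fst b) # fst (snd b), snd (snd b))"

text \<open>Each triple contributes its weight to exactly one label and one point, and the filler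
  points of \<open>Q\<close> have weight zero. So the total over the one-center problems is a sum
  over the input sets.\<close>

lemma sum_wsum:
  assumes "finite Q" "\<forall>(l, p, v)\<in>set bs. l < k \<and> p \<in> Q"
  shows "(\<Sum>j<k. \<Sum>q\<in>Q. wsum (map label bs) (real j # q) * \<psi> j q) = (\<Sum>(l, p, v)\<leftarrow>bs. v * \<psi> l p)"
  using assms(2)
proof (induction bs)
  case Nil
  show ?case by (simp add: wsum_def)
next
  case (Cons b bs)
  obtain l p v where b: "b = (l, p, v)" by (cases b)
  have l: "l < k" "p \<in> Q" using Cons.prems b by auto
  have w: "wsum (map label (b # bs)) (real j # q)
      = (if l = j then if p = q then v else 0 else 0) + wsum (map label bs) (real j # q)" for j q
    by (simp add: wsum_def b label_def)
  have "(\<Sum>j<k. \<Sum>q\<in>Q. (if l = j then if p = q then v else 0 else 0) * \<psi> j q)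
      = (\<Sum>j<k. if l = j then \<Sum>q\<in>Q. if p = q then v * \<psi> j q else 0 else 0)"
    by (intro sum.cong) (auto intro!: sum.cong)
  also have "\<dots> = v * \<psi> l p" using l assms(1) by simp
  finally show ?case
    using Cons by (simp only: w distrib_right sum.distrib) (simp add: b)
qed

lemma cost_list:
  assumes "distinct (map set Ps)"
  shows "cost \<phi> w (set (map set Ps)) C = (\<Sum>ps\<leftarrow>Ps. w (set ps) * set_loss \<phi> (set ps) C)"
  unfolding cost_def using assms
  by (subst sum_list_distinct_conv_sum_set[symmetric]) (simp_all add: o_def)

section \<open>The best candidate and the seeds it depends on\<close>

lemma best_in: "as \<noteq> [] \<Longrightarrow> \<exists>a\<in>set as. \<exists>i'. best \<phi> A \<omega> \<delta> k as i = cand \<phi> A \<omega> \<delta> k a i'"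
proof (induction as arbitrary: i)
  case (Cons a as)
  then show ?case
    by (cases as) (fastforce simp: Let_def)+
qed simp

text \<open>Each earlier candidate consumes \<open>k\<close> seeds. The offset thus identifies the
  seeds of \<open>a\<close>, whose success is what matters.\<close>

lemma best_le:
  "fst (best \<phi> A \<omega> \<delta> k (as @ a # as') i) \<le> fst (cand \<phi> A \<omega> \<delta> k a (i + length as * k))"
proof (induction as arbitrary: i)
  case Nil
  show ?case by (cases as') (auto simp: Let_def)
next
  case (Cons b as)
  obtain c cs where c: "as @ a # as' = c # cs" by (cases "as @ a # as'") auto
  have "fst (best \<phi> A \<omega> \<delta> k (b # (c # cs)) i) \<le> fst (best \<phi> A \<omega> \<delta> k (c # cs) (i + k))"
    by (simp add: Let_def)
  also have "\<dots> \<le> fst (cand \<phi> A \<omega> \<delta> k a (i + k + length as * k))"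
    using Cons.IH c by metis
  finally show ?case by (simp add: c add.assoc)
qed

text \<open>Only a union bound over the \<open>k\<close> calls is needed; their independence is irrelevant.\<close>

lemma with_prob_calls:
  fixes S :: "'a measure"
  assumes S: "prob_space S" and E: "\<And>j. j < k \<Longrightarrow> with_prob S (1 - \<delta>) (Q j)"
    and R: "\<And>\<omega>. \<omega> \<in> space (\<Pi>\<^sub>M i\<in>UNIV. S) \<Longrightarrow> \<forall>j<k. Q j (\<omega> (i + j)) \<Longrightarrow> R \<omega>"
  shows "with_prob (\<Pi>\<^sub>M i\<in>(UNIV :: nat set). S) (1 - real k * \<delta>) R"
proof -
  let ?M = "\<Pi>\<^sub>M i\<in>(UNIV :: nat set). S"
  interpret S: prob_space S by (rule S)
  interpret product_prob_space "\<lambda>_. S" "UNIV :: nat set" by unfold_locales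
  have "\<forall>j<k. \<exists>E\<in>sets S. E \<subseteq> {s \<in> space S. Q j s} \<and> 1 - \<delta> \<le> measure S E"
    using E unfolding with_prob_def by blast
  \<comment> \<open>\<open>with_prob\<close> is an inner probability, so \<open>Q j\<close> itself
    may fail to be measurable; \<open>F j\<close> is an event inside it.\<close>
  then obtain F where F: "\<And>j. j < k \<Longrightarrow> F j \<in> sets S"
    "\<And>j. j < k \<Longrightarrow> F j \<subseteq> {s \<in> space S. Q j s}" "\<And>j. j < k \<Longrightarrow> 1 - \<delta> \<le> measure S (F j)"
    by metis
  define B where "B j = (\<lambda>\<omega>. \<omega> (i + j)) -` (space S - F j) \<inter> space ?M" for j
  have B: "B j \<in> sets ?M" "measure ?M (B j) \<le> \<delta>" if "j < k" for j
  proof -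
    have meas: "(\<lambda>\<omega>. \<omega> (i + j)) \<in> measurable ?M S" by simp
    have c: "space S - F j \<in> sets S" using F(1)[OF that] by auto
    show "B j \<in> sets ?M" unfolding B_def using meas c by (rule measurable_sets)
    have "measure ?M (B j) = measure (distr ?M S (\<lambda>\<omega>. \<omega> (i + j))) (space S - F j)"
      unfolding B_def using measure_distr[OF meas c] by simp
    also have "\<dots> = measure S (space S - F j)" by (simp add: PiM_component)
    also have "\<dots> \<le> \<delta>" using S.prob_compl[OF F(1)[OF that]] F(3)[OF that] by simp
    finally show "measure ?M (B j) \<le> \<delta>" .
  qed
  let ?B = "\<Union>j<k. B j"
  have sB: "?B \<in> sets ?M" using B(1) by auto
  have "measure ?M ?B \<le> (\<Sum>j<k. measure ?M (B j))"
    using B(1) by (intro measure_UNION_le) auto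
  also have "\<dots> \<le> (\<Sum>j<k. \<delta>)" using B(2) by (intro sum_mono) auto
  finally have "1 - real k * \<delta> \<le> measure ?M (space ?M - ?B)"
    using prob_compl[OF sB] by simp
  moreover have "space ?M - ?B \<subseteq> {\<omega> \<in> space ?M. R \<omega>}"
  proof
    fix \<omega> assume \<omega>: "\<omega> \<in> space ?M - ?B"
    have "Q j (\<omega> (i + j))" if "j < k" for j
    proof -
      have "\<omega> (i + j) \<in> space S" using \<omega> by (auto simp: space_PiM)
      moreover have "\<omega> \<notin> B j" using \<omega> that by auto
      ultimately have "\<omega> (i + j) \<in> F j" using \<omega> by (auto simp: B_def)
      then show ?thesis using F(2)[OF that] by auto
    qed
    then show "\<omega> \<in> {\<omega> \<in> space ?M. R \<omega>}" using R \<omega> by auto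
  qed
  ultimately show ?thesis
    unfolding with_prob_def using sB by (intro bexI[of _ "space ?M - ?B"]) auto
qed

section \<open>Correctness for one fixed instance\<close>

locale clustering =
  fixes \<phi> :: "real \<Rightarrow> real" and r :: real and d n m k :: nat and \<P> :: "point set set"
    and w :: "point set \<Rightarrow> real" and \<alpha> \<delta> :: real and S :: "real measure" and A :: solver
    and T :: "nat \<Rightarrow> nat" and Ps :: "point list list"
  assumes loss: "loss_function \<phi> r" and d: "1 \<le> d" and n: "1 \<le> n" and m: "1 \<le> m" and k: "1 \<le> k"
    and nm: "nm_set d n m \<P>" and w: "\<forall>P\<in>\<P>. 0 \<le> w P" and \<alpha>: "1 \<le> \<alpha>"
    and S: "prob_space S" and solver: "solves_one_center \<phi> d \<alpha> \<delta> T S A"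
    and Ps: "distinct (map set Ps)" "set (map set Ps) = \<P>" "\<forall>ps\<in>set Ps. distinct ps"
begin

abbreviation "seeds \<equiv> (\<Pi>\<^sub>M i\<in>(UNIV :: nat set). S)"

definition "Ws = map (\<lambda>ps. (ps, w (set ps))) Ps"
definition "assignments = enum (k * (d + 1) + 1) (map (items k) Ws)"
definition "base a = spread (points a)"
definition "weight a j = (\<lambda>q. wsum a (real j # q))"
definition "opt a = (\<Sum>j<k. INF c\<in>Rd d. point_cost \<phi> (weight a j) (set (base a)) c)"

lemma \<phi>: "mono_on {0..} \<phi>" "\<And>x. 0 \<le> x \<Longrightarrow> 0 \<le> \<phi> x"
  using loss by (auto simp: loss_function_def)

lemma length_Ws: "length Ws = n"
proof -
  have "card (set (map set Ps)) = length (map set Ps)" using Ps(1) by (rule distinct_card)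
  then show ?thesis using Ps(2) nm by (simp add: Ws_def nm_set_def)
qed

lemma Ws_dim: "\<forall>x\<in>set Ws. length (fst x) = m \<and> (\<forall>p\<in>set (fst x). length p = d)"
proof
  fix x assume "x \<in> set Ws"
  then obtain ps where ps: "ps \<in> set Ps" "x = (ps, w (set ps))" by (auto simp: Ws_def)
  then have "set ps \<in> \<P>" using Ps(2) by auto
  then have "set ps \<subseteq> Rd d" "card (set ps) = m" using nm by (auto simp: nm_set_def)
  moreover have "card (set ps) = length ps" using Ps(3) ps(1) by (simp add: distinct_card)
  ultimately show "length (fst x) = m \<and> (\<forall>p\<in>set (fst x). length p = d)"
    using ps(2) by (auto simp: Rd_def)
qed

lemma assignments_ne: "assignments \<noteq> []"
  unfolding assignments_def by (rule enum_ne)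

definition valid :: "(nat \<times> point \<times> real) list \<Rightarrow> bool" where
  "valid bs \<longleftrightarrow> list_all2 (\<lambda>x b. fst b < k \<and> fst (snd b) \<in> set (fst x) \<and> snd (snd b) = snd x) Ws bs"

lemma assignments_valid:
  assumes "a \<in> set assignments"
  obtains bs where "valid bs" "a = map label bs"
proof -
  have "items k x \<noteq> []" if "x \<in> set Ws" for x
  proof -
    have "length (items k x) = m * k"
      using row_shape_items[of x m d k] Ws_dim that by (simp add: row_shape_def)
    then show ?thesis using m k by auto
  qed
  then have "\<forall>r\<in>set (map (items k) Ws). r \<noteq> []" by simp
  then have "list_all2 (\<lambda>r x. x \<in> fst ` set r) (map (items k) Ws) a"
    using enum_tags assms unfolding assignments_def by blast
  then have "list_all2 (\<lambda>x t. \<exists>b. (fst b < k \<and> fst (snd b) \<in> set (fst x) \<and> snd (snd b) = snd x)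
      \<and> t = label b) Ws a"
    unfolding list.rel_map
  proof (rule list_all2_mono)
    fix x t assume "t \<in> fst ` set (items k x)"
    then obtain p l where "p \<in> set (fst x)" "l < k" "t = (real l # p, snd x)"
      by (auto simp: set_items)
    then show "\<exists>b. (fst b < k \<and> fst (snd b) \<in> set (fst x) \<and> snd (snd b) = snd x) \<and> t = label b"
      by (intro exI[of _ "(l, p, snd x)"]) (simp add: label_def)
  qed
  then have "\<exists>bs. valid bs \<and> a = map label bs"
    unfolding valid_def
  proof (induction rule: list_all2_induct)
    case (Cons x xs t ts)
    then obtain b bs where "fst b < k \<and> fst (snd b) \<in> set (fst x) \<and> snd (snd b) = snd x"
      "t = label b" "list_all2 (\<lambda>x b. fst b < k \<and> fst (snd b) \<in> set (fst x) \<and> snd (snd b) = snd x) xs bs"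
      "ts = map label bs" by blast
    then show ?case by (intro exI[of _ "b # bs"]) simp
  qed simp
  then show ?thesis using that by blast
qed

lemma valid_points:
  assumes "valid bs" "a = map label bs"
  shows "length a = n" "\<forall>t\<in>set a. length (fst t) = Suc d \<and> 0 \<le> snd t"
    "\<forall>p\<in>set (points a). length p = d" "length (points a) = n"
    "\<forall>(l, p, v)\<in>set bs. l < k \<and> p \<in> set (points a)"
proof -
  have Ws0: "0 \<le> snd x" if "x \<in> set Ws" for x
    using that w Ps(2) by (auto simp: Ws_def)
  have b: "fst b < k \<and> length (fst (snd b)) = d \<and> 0 \<le> snd (snd b)" if b: "b \<in> set bs" for b
  proof -
    obtain i where i: "i < length bs" "b = bs ! i" using b by (metis in_set_conv_nth)
    then have "i < length Ws" "fst b < k" "fst (snd b) \<in> set (fst (Ws ! i))" "snd (snd b) = snd (Ws ! i)"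
      using assms(1) by (auto simp: valid_def list_all2_conv_all_nth)
    moreover from this have W: "Ws ! i \<in> set Ws" by simp
    ultimately show ?thesis using bspec[OF Ws_dim W] Ws0[OF W] by simp
  qed
  show "length a = n"
    using assms length_Ws by (auto simp: valid_def dest: list_all2_lengthD)
  then show "length (points a) = n" by (simp add: points_def)
  show t: "\<forall>t\<in>set a. length (fst t) = Suc d \<and> 0 \<le> snd t"
    using b assms(2) by (auto simp: label_def)
  then show "\<forall>p\<in>set (points a). length p = d" by (auto simp: points_def)
  show "\<forall>(l, p, v)\<in>set bs. l < k \<and> p \<in> set (points a)"
  proof (clarify)
    fix l p v assume *: "(l, p, v) \<in> set bs"
    have "p = (tl \<circ> fst) (label (l, p, v))" by (simp add: label_def)
    then have "p \<in> set (points a)" unfolding points_def assms(2) using * by (metis image_eqI list.set_map)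
    then show "l < k \<and> p \<in> set (points a)" using b[OF *] by simp
  qed
qed

lemma base_props:
  assumes "a \<in> set assignments"
  shows "length (base a) = n" "distinct (base a)" "\<forall>q\<in>set (base a). length q = d"
    "set (points a) \<subseteq> set (base a)" "card (set (base a)) = n" "set (base a) \<subseteq> Rd d"
proof -
  obtain bs where bs: "valid bs" "a = map label bs" using assms by (rule assignments_valid)
  have "0 < d" using d by simp
  note * = spread_props[OF this valid_points(3)[OF bs], folded base_def]
  show "length (base a) = n" "distinct (base a)" "\<forall>q\<in>set (base a). length q = d"
    "set (points a) \<subseteq> set (base a)" using * valid_points(4)[OF bs] by auto
  then show "card (set (base a)) = n" "set (base a) \<subseteq> Rd d"
    by (auto simp: distinct_card Rd_def)
qed

text \<open>Padding gives every instance exactly \<open>n\<close> points, also if some or all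
  weights are zero. So the same bound \<open>T n\<close> applies to every call.\<close>

lemma solver_assignment:
  assumes a: "a \<in> set assignments"
  shows "s \<in> space S \<Longrightarrow> length (fst (A s \<delta> (weigh a j (base a)))) = d"
    and "s \<in> space S \<Longrightarrow> 0 < snd (A s \<delta> (weigh a j (base a)))"
    and "s \<in> space S \<Longrightarrow> snd (A s \<delta> (weigh a j (base a))) \<le> T n"
    and "with_prob S (1 - \<delta>) (\<lambda>s.
      point_cost \<phi> (weight a j) (set (base a)) (fst (A s \<delta> (weigh a j (base a))))
        \<le> \<alpha> * (INF c\<in>Rd d. point_cost \<phi> (weight a j) (set (base a)) c))"
proof -
  obtain bs where bs: "valid bs" "a = map label bs" using a by (rule assignments_valid)
  have "\<forall>q\<in>set (base a). 0 \<le> weight a j q"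
    using valid_points(2)[OF bs] by (auto simp: weight_def wsum_def intro!: sum_list_nonneg)
  then have prem: "set (base a) \<subseteq> Rd d \<and> (\<forall>q\<in>set (base a). 0 \<le> weight a j q)
      \<and> distinct (base a) \<and> set (base a) = set (base a)"
    using base_props[OF a] by simp
  have weigh: "map (\<lambda>q. (q, weight a j q)) (base a) = weigh a j (base a)"
    by (simp add: weigh_def weight_def)
  note sol = solver[unfolded solves_one_center_def, THEN spec[of _ "set (base a)"],
      THEN spec[of _ "weight a j"], THEN spec[of _ "base a"], THEN mp, OF prem,
      unfolded weigh base_props(5)[OF a]]
  show "length (fst (A s \<delta> (weigh a j (base a)))) = d" if "s \<in> space S"
    using bspec[OF conjunct1[OF sol] that] by (simp add: Rd_def)
  show "0 < snd (A s \<delta> (weigh a j (base a)))" if "s \<in> space S"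
    using bspec[OF conjunct1[OF sol] that] by simp
  show "snd (A s \<delta> (weigh a j (base a))) \<le> T n" if "s \<in> space S"
    using bspec[OF conjunct1[OF sol] that] by simp
  show "with_prob S (1 - \<delta>) (\<lambda>s.
      point_cost \<phi> (weight a j) (set (base a)) (fst (A s \<delta> (weigh a j (base a))))
        \<le> \<alpha> * (INF c\<in>Rd d. point_cost \<phi> (weight a j) (set (base a)) c))"
    by (rule conjunct2[OF sol])
qed

lemma pcost_assignment:
  assumes "a \<in> set assignments" "length c = d"
  shows "pcost \<phi> (weigh a j (base a)) c = point_cost \<phi> (weight a j) (set (base a)) c"
  unfolding weight_def using base_props[OF assms(1)] assms(2) by (intro pcost_weigh) auto

lemma point_cost_assignment:
  assumes a: "a \<in> set assignments" and bs: "valid bs" "a = map label bs"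
  shows "(\<Sum>j<k. point_cost \<phi> (weight a j) (set (base a)) (c j))
    = (\<Sum>b\<leftarrow>bs. snd (snd b) * \<phi> (edist (fst (snd b)) (c (fst b))))"
proof -
  have "(\<Sum>j<k. point_cost \<phi> (weight a j) (set (base a)) (c j))
      = (\<Sum>j<k. \<Sum>q\<in>set (base a). wsum (map label bs) (real j # q) * \<phi> (edist q (c j)))"
    by (simp add: point_cost_def weight_def set_loss_single bs(2))
  also have "\<dots> = (\<Sum>(l, p, v)\<leftarrow>bs. v * \<phi> (edist p (c l)))"
    using valid_points(5)[OF bs] base_props(4)[OF a] by (intro sum_wsum) auto
  finally show ?thesis by (simp add: case_prod_beta')
qed

lemma cost_Ws: "cost \<phi> w \<P> C = (\<Sum>x\<leftarrow>Ws. snd x * set_loss \<phi> (set (fst x)) C)"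
  using cost_list[OF Ps(1), of \<phi> w C] unfolding Ps(2) by (simp add: Ws_def o_def)

text \<open>The assigned pair is one of the pairs over which the loss of a set is minimized, and
  \<open>spread\<close> keeps all computed centers. Hence the value computed by the program is an
  upper bound for any assignment.\<close>

lemma cost_le_cand:
  assumes a: "a \<in> set assignments" and \<omega>: "\<omega> \<in> space seeds"
  shows "cost \<phi> w \<P> (set (snd (cand \<phi> A \<omega> \<delta> k a i))) \<le> fst (cand \<phi> A \<omega> \<delta> k a i)"
    and "set (snd (cand \<phi> A \<omega> \<delta> k a i)) \<in> centers d k"
    and "distinct (snd (cand \<phi> A \<omega> \<delta> k a i))"
proof -
  obtain bs where bs: "valid bs" "a = map label bs" using a by (rule assignments_valid)
  let ?c = "center A \<omega> \<delta> a i"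
  let ?C = "spread (map ?c (rev [0..<k]))"
  have "\<omega> j \<in> space S" for j using \<omega> by (auto simp: space_PiM)
  then have c: "length (?c j) = d" for j
    using solver_assignment(1)[OF a] by (simp add: center_def base_def)
  have d0: "0 < d" using d by simp
  have dim: "\<forall>x\<in>set (map ?c (rev [0..<k])). length x = d" using c by simp
  note sp' = spread_props[OF d0 dim]
  have sp: "length ?C = k" "distinct ?C" "\<forall>x\<in>set ?C. length x = d" "?c ` {..<k} \<subseteq> set ?C"
    using sp'(1) sp'(2,3) sp'(4) by (simp_all add: atLeast0LessThan)
  have "(\<Sum>x\<leftarrow>Ws. snd x * set_loss \<phi> (set (fst x)) (set ?C))
      \<le> (\<Sum>b\<leftarrow>bs. snd (snd b) * \<phi> (edist (fst (snd b)) (?c (fst b))))"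
  proof -
    have "\<forall>x\<in>set Ws. 0 \<le> snd x" using w Ps(2) by (auto simp: Ws_def)
    with bs(1) show ?thesis unfolding valid_def
    proof (induction rule: list_all2_induct)
      case (Cons x xs b bs)
      have b: "fst b < k" "fst (snd b) \<in> set (fst x)" "snd (snd b) = snd x" "0 \<le> snd x"
        using Cons.hyps(1) Cons.prems by simp_all
      have c: "?c (fst b) \<in> set ?C" using sp(4) b(1) by blast
      have "set_loss \<phi> (set (fst x)) (set ?C) \<le> \<phi> (edist (fst (snd b)) (?c (fst b)))"
        by (rule set_loss_le[OF _ _ b(2) c]) simp_all
      then have "snd x * set_loss \<phi> (set (fst x)) (set ?C)
          \<le> snd (snd b) * \<phi> (edist (fst (snd b)) (?c (fst b)))"
        unfolding b(3) using b(4) by (rule mult_left_mono)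
      moreover have "(\<Sum>x\<leftarrow>xs. snd x * set_loss \<phi> (set (fst x)) (set ?C))
          \<le> (\<Sum>b\<leftarrow>bs. snd (snd b) * \<phi> (edist (fst (snd b)) (?c (fst b))))"
        using Cons.prems by (intro Cons.IH) simp
      ultimately show ?case unfolding list.map sum_list.Cons by (rule add_mono)
    qed simp
  qed
  also have "\<dots> = (\<Sum>j<k. point_cost \<phi> (weight a j) (set (base a)) (?c j))"
    using point_cost_assignment[OF a bs] by simp
  also have "\<dots> = fst (cand \<phi> A \<omega> \<delta> k a i)"
    using c pcost_assignment[OF a] by (simp add: cand_def base_def)
  finally show "cost \<phi> w \<P> (set (snd (cand \<phi> A \<omega> \<delta> k a i))) \<le> fst (cand \<phi> A \<omega> \<delta> k a i)"
    by (simp add: cost_Ws cand_def)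
  show "set (snd (cand \<phi> A \<omega> \<delta> k a i)) \<in> centers d k"
    "distinct (snd (cand \<phi> A \<omega> \<delta> k a i))"
    using sp by (auto simp: cand_def centers_def Rd_def distinct_card)
qed

text \<open>Supplies the lower bound that makes the infimum in \<open>opt\<close> usable.\<close>

lemma point_cost_nonneg:
  assumes a: "a \<in> set assignments"
  shows "0 \<le> point_cost \<phi> (weight a j) (set (base a)) c"
proof -
  obtain bs where bs: "valid bs" "a = map label bs" using a by (rule assignments_valid)
  have "0 \<le> weight a j q" for q
    using valid_points(2)[OF bs] by (auto simp: weight_def wsum_def intro!: sum_list_nonneg)
  then show ?thesis
    unfolding point_cost_def set_loss_single using \<phi>(2) edist_nonneg
    by (intro sum_nonneg mult_nonneg_nonneg) auto
qed

text \<open>For the assignment to nearest pairs the upper bound is exact, because \<phi> is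
  monotone. Replacing each given center by the optimum of its own one-center problem can only lower
  the sum.\<close>

lemma opt_le_cost:
  assumes C: "C \<in> centers d k"
  shows "\<exists>a\<in>set assignments. opt a \<le> cost \<phi> w \<P> C"
proof -
  have fC: "finite C" and cC: "card C = k" and CR: "C \<subseteq> Rd d"
    using C by (auto simp: centers_def)
  obtain c where "bij_betw c {..<k} C"
    using ex_bij_betw_nat_finite[OF fC] cC by (auto simp: atLeast0LessThan)
  then have c: "c ` {..<k} = C" by (simp add: bij_betw_def)
  then have cd: "\<forall>j<k. length (c j) = d" using CR by (auto simp: Rd_def)
  have pos: "0 < k" "0 < m" using k m by auto
  obtain a where a: "a \<in> set assignments" and near:
    "list_all2 (\<lambda>x t. \<exists>l<k. \<exists>p\<in>set (fst x). t = (real l # p, snd x) \<and>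
      (\<forall>p'\<in>set (fst x). \<forall>l'<k. sqdist p (c l) \<le> sqdist p' (c l'))) Ws a"
    using enum_nearest[OF cd pos Ws_dim] unfolding assignments_def by blast
  obtain bs where bs: "valid bs" "a = map label bs" using a by (rule assignments_valid)
  have "(\<Sum>x\<leftarrow>Ws. snd x * set_loss \<phi> (set (fst x)) C)
      = (\<Sum>b\<leftarrow>bs. snd (snd b) * \<phi> (edist (fst (snd b)) (c (fst b))))"
    using near Ws_dim unfolding bs(2) list.rel_map
  proof (induction rule: list_all2_induct)
    case (Cons x xs b bs)
    from Cons.hyps(1) obtain l p where lp: "l < k" "p \<in> set (fst x)" "label b = (real l # p, snd x)"
      and min: "\<forall>p'\<in>set (fst x). \<forall>l'<k. sqdist p (c l) \<le> sqdist p' (c l')" by blast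
    have b: "fst b = l" "fst (snd b) = p" "snd (snd b) = snd x"
      using lp(3) by (auto simp: label_def)
    have dim: "length q = d" if "q \<in> set (fst x)" for q using Cons.prems that by auto
    have "set_loss \<phi> (set (fst x)) C = \<phi> (edist p (c l))"
    proof (rule set_loss_eq[OF _ fC lp(2) _ \<phi>(1)])
      fix p' c' assume "p' \<in> set (fst x)" "c' \<in> C"
      then show "edist p (c l) \<le> edist p' c'"
        using min dim lp cd c by (auto simp: edist_eq)
    qed (use lp c in auto)
    moreover have "(\<Sum>x\<leftarrow>xs. snd x * set_loss \<phi> (set (fst x)) C)
        = (\<Sum>b\<leftarrow>bs. snd (snd b) * \<phi> (edist (fst (snd b)) (c (fst b))))"
      using Cons.prems by (intro Cons.IH) simp
    ultimately show ?case unfolding list.map sum_list.Cons b by (simp only:)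
  qed simp
  also have "\<dots> = (\<Sum>j<k. point_cost \<phi> (weight a j) (set (base a)) (c j))"
    using point_cost_assignment[OF a bs] by simp
  also have "\<dots> \<ge> opt a"
    unfolding opt_def
  proof (rule sum_mono)
    fix j assume "j \<in> {..<k}"
    then have "c j \<in> Rd d" using cd by (simp add: Rd_def)
    then show "(INF c\<in>Rd d. point_cost \<phi> (weight a j) (set (base a)) c)
        \<le> point_cost \<phi> (weight a j) (set (base a)) (c j)"
      by (intro cINF_lower bdd_belowI[of _ 0]) (auto intro: point_cost_nonneg[OF a])
  qed
  finally show ?thesis using a by (auto simp: cost_Ws)
qed

lemma centers_ne: "centers d k \<noteq> {}"
proof -
  have inj: "inj (\<lambda>i. replicate d (real i))" using d by (auto intro!: injI simp: replicate_eq_replicate)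
  have "(\<lambda>i. replicate d (real i)) ` {..<k} \<in> centers d k"
    using inj by (auto simp: centers_def Rd_def card_image inj_on_subset[OF inj])
  then show ?thesis by auto
qed

text \<open>No optimal set of centers is used: \<open>a\<close> minimizes \<open>opt\<close> over
  the finite list of assignments, so \<open>opt a\<close> is below the cost of every
  \<open>C\<close> and hence below the infimum. As \<open>opt\<close> does not involve the seeds,
  the \<open>k\<close> calls that have to succeed are fixed in advance.\<close>

lemma cost_best:
  "with_prob seeds (1 - real k * \<delta>) (\<lambda>\<omega>.
     cost \<phi> w \<P> (set (snd (best \<phi> A \<omega> \<delta> k assignments 0)))
       \<le> \<alpha> * (INF C\<in>centers d k. cost \<phi> w \<P> C))"
proof -
  obtain a where a: "a \<in> set assignments" and min: "\<And>a'. a' \<in> set assignments \<Longrightarrow> opt a \<le> opt a'"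
    using ex_min_on[of "set assignments" opt] assignments_ne by auto
  obtain as as' where as: "assignments = as @ a # as'" using split_list[OF a] by blast
  have "opt a \<le> (INF C\<in>centers d k. cost \<phi> w \<P> C)"
    using centers_ne opt_le_cost min by (intro cINF_greatest) (auto intro: order_trans)
  then have opt: "\<alpha> * opt a \<le> \<alpha> * (INF C\<in>centers d k. cost \<phi> w \<P> C)"
    using \<alpha> by simp
  show ?thesis
  proof (rule with_prob_calls[OF S solver_assignment(4)[OF a], of k _ "length as * k"])
    fix \<omega> assume \<omega>: "\<omega> \<in> space seeds"
    let ?c = "center A \<omega> \<delta> a (length as * k)"
    assume good: "\<forall>j<k. point_cost \<phi> (weight a j) (set (base a))
        (fst (A (\<omega> (length as * k + j)) \<delta> (weigh a j (base a))))
        \<le> \<alpha> * (INF c\<in>Rd d. point_cost \<phi> (weight a j) (set (base a)) c)"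
    have "\<omega> j \<in> space S" for j using \<omega> by (auto simp: space_PiM)
    then have c: "length (?c j) = d" for j
      using solver_assignment(1)[OF a] by (simp add: center_def base_def)
    obtain a' i' where a': "a' \<in> set assignments"
      "best \<phi> A \<omega> \<delta> k assignments 0 = cand \<phi> A \<omega> \<delta> k a' i'"
      using best_in[OF assignments_ne] by metis
    have "cost \<phi> w \<P> (set (snd (best \<phi> A \<omega> \<delta> k assignments 0)))
        \<le> fst (best \<phi> A \<omega> \<delta> k assignments 0)"
      unfolding a'(2) by (rule cost_le_cand(1)[OF a'(1) \<omega>])
    also have "\<dots> \<le> fst (cand \<phi> A \<omega> \<delta> k a (length as * k))"
      using best_le[of \<phi> A \<omega> \<delta> k as a as' 0] as by simp
    also have "\<dots> = (\<Sum>j<k. point_cost \<phi> (weight a j) (set (base a)) (?c j))"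
      using c pcost_assignment[OF a] by (simp add: cand_def base_def)
    also have "\<dots> \<le> (\<Sum>j<k. \<alpha> * (INF c\<in>Rd d. point_cost \<phi> (weight a j) (set (base a)) c))"
      using good by (intro sum_mono) (auto simp: center_def base_def)
    also have "\<dots> = \<alpha> * opt a" by (simp add: opt_def sum_distrib_left)
    finally show "cost \<phi> w \<P> (set (snd (best \<phi> A \<omega> \<delta> k assignments 0)))
       \<le> \<alpha> * (INF C\<in>centers d k. cost \<phi> w \<P> C)" using opt by simp
  qed
qed

text \<open>The claimed time is a multiple of \<open>T n\<close>, which therefore has to pay for the
  fixed overhead too.\<close>

lemma T_pos: "1 \<le> T n"
proof -
  obtain a where a: "a \<in> set assignments" using assignments_ne by (cases assignments) auto
  obtain s where s: "s \<in> space S" using prob_space.not_empty[OF S] by auto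
  show ?thesis using solver_assignment(2,3)[OF a s, of 0] by simp
qed

section \<open>Runs of the whole program\<close>

definition "input = [enc_weighted_sets Ws, Atom (real k), Atom \<delta>]"

lemma runs_toI:
  assumes "evals \<phi> A \<omega> input 0 main_body v B j"
  shows "\<exists>t\<le>B. runs_to \<phi> A \<omega> cluster_prog input v t"
  using assms unfolding evals_def runs_to_def by (auto simp: cluster_prog_def)

lemma runs_general:
  assumes nmk: "2 \<le> n * m * k" and \<omega>: "\<omega> \<in> space seeds"
  shows "\<exists>t\<le>1000000 * T n * (n * m * k) ^ (1000000 * d * k).
    runs_to \<phi> A \<omega> cluster_prog input
      (enc_list enc_point (snd (best \<phi> A \<omega> \<delta> k assignments 0))) t"
proof -
  have pos: "0 < d" "0 < m" "0 < k" "Ws \<noteq> []" using d m k n length_Ws by auto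
  have \<omega>S: "\<omega> i \<in> space S" for i using \<omega> by (auto simp: space_PiM)
  have "good_solver A \<omega> d \<delta> (T n) a" if a: "a \<in> set assignments" for a
  proof -
    obtain bs where bs: "valid bs" "a = map label bs" using a by (rule assignments_valid)
    show ?thesis
      unfolding good_solver_def using valid_points(2)[OF bs] solver_assignment(1,3)[OF a \<omega>S]
      by (auto simp: base_def)
  qed
  then obtain B j where gen: "calls \<phi> A \<omega> f_general input 0
      (enc_list enc_point (snd (best \<phi> A \<omega> \<delta> k assignments 0))) B j"
    and B: "B + 100 \<le> 1000000 * T n * (n * m * k) ^ (1000000 * d * k)"
    using general_calls[OF pos length_Ws Ws_dim, of A \<omega> \<delta> "T n" \<phi>] time_bound[OF nmk d T_pos]
    unfolding assignments_def[symmetric] input_def[symmetric] by blast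
  obtain x Ws' where W: "Ws = x # Ws'" using pos by (cases Ws) auto
  obtain p ps where p: "fst x = p # ps" using Ws_dim pos W by (cases "fst x") auto
  have inp: "input = [Cell (Cell (Cell (enc_point p) (enc_list enc_point ps)) (Atom (snd x)))
      (enc_list enc_wset Ws'), Atom (real k), Atom \<delta>]"
    by (simp add: input_def W enc_weighted_sets_eq enc_wset_def[of x] p)
  have call: "evals \<phi> A \<omega> input 0 (Call f_general [Var 0, Var 1, Var 2])
      (enc_list enc_point (snd (best \<phi> A \<omega> \<delta> k assignments 0))) (B + 50) j"
    unfolding inp
    apply (rule evals_mono)
       apply (rule evals_rules gen[unfolded inp])+
    by simp_all
  have "evals \<phi> A \<omega> input 0 main_body
      (enc_list enc_point (snd (best \<phi> A \<omega> \<delta> k assignments 0))) (B + 100) j"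
  proof (cases "1 < real k")
    case True
    show ?thesis
      unfolding inp main_body_def Let_def
      apply (rule evals_mono)
         apply (rule evals_IfLess evals_Const evals_Var evals_if_const(1)[OF True] call[unfolded inp])+
      by simp_all
  next
    case False
    then have k1: "k = 1" using k by simp
    show ?thesis
    proof (cases Ws')
      case (Cons y ys)
      show ?thesis
        unfolding inp main_body_def Let_def Cons enc_list.simps enc_wset_def[of y]
        apply (rule evals_mono)
           apply (rule evals_IfLess evals_Const evals_Var evals_if_const(2)[OF False] evals_IfNul
              evals_Snd evals_Fst evals_if_Nul
              call[unfolded inp Cons enc_list.simps enc_wset_def[of y]])+
        by simp_all
    next
      case Nil
      \<comment> \<open>With \<open>n = k = 1\<close> the assumption forces \<open>2 <= m\<close>,
        so the first set has a second point and the last test of \<open>main_body\<close> also leads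
        to the general case.\<close>
      then have "n = 1" using length_Ws W by simp
      then have "ps \<noteq> []" using nmk k1 Ws_dim W p by (cases ps) auto
      then obtain q qs where q: "ps = q # qs" by (cases ps) auto
      obtain u v where pq: "enc_list enc_point ps = Cell u v" by (simp add: q)
      show ?thesis
        unfolding inp main_body_def Let_def Nil enc_list.simps pq
        apply (rule evals_mono)
           apply (rule evals_IfLess evals_Const evals_Var evals_if_const(2)[OF False] evals_IfNul
              evals_Snd evals_Fst evals_if_Nul call[unfolded inp Nil enc_list.simps pq])+
        by simp_all
    qed
  qed
  then obtain t where "t \<le> B + 100" "runs_to \<phi> A \<omega> cluster_prog input
      (enc_list enc_point (snd (best \<phi> A \<omega> \<delta> k assignments 0))) t"
    using runs_toI by blast
  then show ?thesis using B by (meson order_trans)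
qed

lemma result_general:
  assumes nmk: "2 \<le> n * m * k"
  shows "\<exists>Chat. (\<forall>\<omega>\<in>space seeds. Chat \<omega> \<in> centers d k \<and>
      (\<exists>cs t. distinct cs \<and> set cs = Chat \<omega> \<and>
        runs_to \<phi> A \<omega> cluster_prog input (enc_list enc_point cs) t \<and>
        t \<le> 1000000 * T n * (n * m * k) ^ (1000000 * d * k))) \<and>
    with_prob seeds (1 - real k * \<delta>)
      (\<lambda>\<omega>. cost \<phi> w \<P> (Chat \<omega>) \<le> \<alpha> * (INF C\<in>centers d k. cost \<phi> w \<P> C))"
proof (rule exI[of _ "\<lambda>\<omega>. set (snd (best \<phi> A \<omega> \<delta> k assignments 0))"], intro conjI ballI cost_best)
  fix \<omega> assume \<omega>: "\<omega> \<in> space seeds"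
  obtain a i where a: "a \<in> set assignments"
    "best \<phi> A \<omega> \<delta> k assignments 0 = cand \<phi> A \<omega> \<delta> k a i"
    using best_in[OF assignments_ne] by metis
  show "set (snd (best \<phi> A \<omega> \<delta> k assignments 0)) \<in> centers d k"
    unfolding a(2) by (rule cost_le_cand(2)[OF a(1) \<omega>])
  have "distinct (snd (best \<phi> A \<omega> \<delta> k assignments 0))"
    unfolding a(2) by (rule cost_le_cand(3)[OF a(1) \<omega>])
  then show "\<exists>cs t. distinct cs \<and> set cs = set (snd (best \<phi> A \<omega> \<delta> k assignments 0)) \<and>
      runs_to \<phi> A \<omega> cluster_prog input (enc_list enc_point cs) t \<and>
      t \<le> 1000000 * T n * (n * m * k) ^ (1000000 * d * k)"
    using runs_general[OF nmk \<omega>] by blast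
qed

text \<open>Sets of one center are singletons, so the infimum over \<open>centers d k\<close> is the
  one in the guarantee of the black box, and its answer is returned unchanged.\<close>

lemma result_single:
  assumes nmk: "n = 1" "m = 1" "k = 1"
  shows "\<exists>Chat. (\<forall>\<omega>\<in>space seeds. Chat \<omega> \<in> centers d k \<and>
      (\<exists>cs t. distinct cs \<and> set cs = Chat \<omega> \<and>
        runs_to \<phi> A \<omega> cluster_prog input (enc_list enc_point cs) t \<and>
        t \<le> 1000000 * T n * (n * m * k) ^ (1000000 * d * k))) \<and>
    with_prob seeds (1 - real k * \<delta>)
      (\<lambda>\<omega>. cost \<phi> w \<P> (Chat \<omega>) \<le> \<alpha> * (INF C\<in>centers d k. cost \<phi> w \<P> C))"
proof -
  obtain x where W: "Ws = [x]" using length_Ws nmk(1) by (auto simp: length_Suc_conv)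
  obtain p where p: "fst x = [p]" "length p = d"
    using Ws_dim nmk(2) by (auto simp: W length_Suc_conv)
  obtain v where x: "x = ([p], v)" using p by (cases x) auto
  have v: "0 \<le> v" using W x w Ps(2) by (auto simp: Ws_def)
  define c where "c s = fst (A s \<delta> [(p, v)])" for s
  have sol: "(\<forall>s\<in>space S. c s \<in> Rd d \<and> 0 < snd (A s \<delta> [(p, v)]) \<and> snd (A s \<delta> [(p, v)]) \<le> T n) \<and>
      with_prob S (1 - \<delta>) (\<lambda>s. point_cost \<phi> (\<lambda>_. v) {p} (c s)
        \<le> \<alpha> * (INF c\<in>Rd d. point_cost \<phi> (\<lambda>_. v) {p} c))"
    using solver[unfolded solves_one_center_def, rule_format, of "{p}" "\<lambda>_. v" "[p]"] p(2) v nmk(1)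
    by (simp add: c_def Rd_def)
  have cost: "cost \<phi> w \<P> {c} = point_cost \<phi> (\<lambda>_. v) {p} c" for c
    by (simp add: cost_Ws W x point_cost_def)
  have "centers d k = (\<lambda>c. {c}) ` Rd d"
    using nmk(3) by (auto simp: centers_def card_1_singleton_iff)
  then have INF: "(INF C\<in>centers d k. cost \<phi> w \<P> C) = (INF c\<in>Rd d. point_cost \<phi> (\<lambda>_. v) {p} c)"
    by (simp add: image_image cost)
  have inp: "input = [Cell (Cell (Cell (enc_point p) Nul) (Atom v)) Nul, Atom 1, Atom \<delta>]"
    unfolding input_def W enc_weighted_sets_eq enc_list.simps
    by (simp add: enc_wset_def x nmk(3) enc_point_simps)
  show ?thesis
  proof (rule exI[of _ "\<lambda>\<omega>. {c (\<omega> 0)}"], intro conjI ballI)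
    fix \<omega> assume "\<omega> \<in> space seeds"
    then have "\<omega> 0 \<in> space S" by (auto simp: space_PiM)
    then have c: "c (\<omega> 0) \<in> Rd d" and t: "snd (A (\<omega> 0) \<delta> [(p, v)]) \<le> T n" using sol by auto
    show "{c (\<omega> 0)} \<in> centers d k" using c nmk(3) by (simp add: centers_def)
    note solve = evals_Solve[where \<phi> = \<phi> and A = A and \<omega> = \<omega> and xs = "[(p, v)]",
        unfolded enc_weighted_points_eq enc_list.simps enc_tag_Pair]
    have "evals \<phi> A \<omega> input 0 main_body (enc_list enc_point [c (\<omega> 0)]) (50 + T n) 1"
      unfolding inp main_body_def Let_def
      apply (rule evals_mono)
         apply (rule evals_IfLess evals_Const evals_Var evals_if_const(2)[of "1 < (1::real)"]
            evals_IfNul evals_Snd evals_Fst evals_if_Nul evals_MkCell evals_MkNul solve t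
            | (simp; fail))+
      by (simp_all add: c_def)?
    then obtain t where "t \<le> 50 + T n"
      "runs_to \<phi> A \<omega> cluster_prog input (enc_list enc_point [c (\<omega> 0)]) t"
      using runs_toI by blast
    moreover have "50 + T n \<le> 1000000 * T n * (n * m * k) ^ (1000000 * d * k)"
      using T_pos nmk by simp
    ultimately show "\<exists>cs t. distinct cs \<and> set cs = {c (\<omega> 0)} \<and>
        runs_to \<phi> A \<omega> cluster_prog input (enc_list enc_point cs) t \<and>
        t \<le> 1000000 * T n * (n * m * k) ^ (1000000 * d * k)"
      by (intro exI[of _ "[c (\<omega> 0)]"] exI[of _ t]) auto
  next
    have "with_prob S (1 - \<delta>) (\<lambda>s. cost \<phi> w \<P> {c s} \<le> \<alpha> * (INF C\<in>centers d k. cost \<phi> w \<P> C))"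
      using sol by (simp add: cost INF)
    then show "with_prob seeds (1 - real k * \<delta>) (\<lambda>\<omega>. cost \<phi> w \<P> {c (\<omega> 0)}
        \<le> \<alpha> * (INF C\<in>centers d k. cost \<phi> w \<P> C))"
      by (rule with_prob_calls[OF S, where i = 0]) (use nmk(3) in auto)
  qed
qed

end

theorem theorem4p3:
  shows "\<exists>(prog::program) (b::nat).
    \<forall>(\<phi>::real \<Rightarrow> real) (r::real) (d::nat) (n::nat) (m::nat) (k::nat)
      (\<P>::point set set) (w::point set \<Rightarrow> real) (\<alpha>::real) (\<delta>::real)
      (S::real measure) (A::solver) (T::nat \<Rightarrow> nat) (Ps::point list list).
      loss_function \<phi> r \<and> 1 \<le> d \<and> 1 \<le> n \<and> 1 \<le> m \<and> 1 \<le> k \<and>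
      nm_set d n m \<P> \<and> (\<forall>P\<in>\<P>. 0 \<le> w P) \<and>
      1 \<le> \<alpha> \<and> 0 \<le> \<delta> \<and> \<delta> < 1 \<and>
      prob_space S \<and> solves_one_center \<phi> d \<alpha> \<delta> T S A \<and>
      distinct (map set Ps) \<and> set (map set Ps) = \<P> \<and> (\<forall>ps\<in>set Ps. distinct ps)
      \<longrightarrow>
      (\<exists>Chat :: (nat \<Rightarrow> real) \<Rightarrow> point set.
        (\<forall>\<omega>\<in>space (\<Pi>\<^sub>M i\<in>UNIV. S).
           Chat \<omega> \<in> centers d k \<and>
           (\<exists>cs t. distinct cs \<and> set cs = Chat \<omega> \<and>
              runs_to \<phi> A \<omega> prog
                [enc_weighted_sets (map (\<lambda>ps. (ps, w (set ps))) Ps), Atom (real k), Atom \<delta>]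
                (enc_list enc_point cs) t \<and>
              t \<le> b * T n * (n * m * k) ^ (b * d * k))) \<and>
        with_prob (\<Pi>\<^sub>M i\<in>UNIV. S) (1 - real k * \<delta>)
          (\<lambda>\<omega>. cost \<phi> w \<P> (Chat \<omega>) \<le> \<alpha> * (INF C\<in>centers d k. cost \<phi> w \<P> C)))"
proof (rule exI[of _ cluster_prog], rule exI[of _ 1000000], intro allI impI, elim conjE, goal_cases)
  case (1 \<phi> r d n m k \<P> w \<alpha> \<delta> S A T Ps)
  then have "clustering \<phi> r d n m k \<P> w \<alpha> \<delta> S A T Ps"
    by (simp add: clustering_def)
  then interpret clustering \<phi> r d n m k \<P> w \<alpha> \<delta> S A T Ps .
  \<comment> \<open>In the second case the power in the bound equals 1, independently of
    \<open>d\<close>.\<close>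
  have "2 \<le> n * m * k \<or> n = 1 \<and> m = 1 \<and> k = 1"
  proof (rule disjCI)
    assume "\<not> (n = 1 \<and> m = 1 \<and> k = 1)"
    then have "n * m * k \<noteq> 1" by simp
    moreover have "0 < n * m * k" using n m k by simp
    ultimately show "2 \<le> n * m * k" by linarith
  qed
  then show ?case
    using result_general result_single unfolding input_def Ws_def by blast
qed

end
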